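(* Let $S$ be a Polish semigroup and let $\mu$ be a Borel probability measure on $S$ such that $\mu * \mu = \mu$. Then the topological support $\mathcal{S}(\mu)$ is a completely simple semigroup and its group factor is compact. Moreover, let $e\in E(\mathcal{S}(\mu))$ and let $\mathcal{S}(\mu)=LGR$ denote the Rees decomposition at $e$. Then $\mu$ admits the convolution factorization $$\mu = \mu^L * \omega_G * \mu^R,$$ where $\omega_G$ is the normalized unimodular Haar measure on the compact Polish group $G$.
   Context: A Polish semigroup is a semigroup with a Polish (separable, completely metrizable) topology for which multiplication is jointly continuous. The convolution of Borel probability measures is $(\mu*\nu)(B)=\iint 1_B(xy)\,\mu(dx)\,\nu(dy)$. The topological support $\mathcal{S}(\mu)$ is the set of $x$ such that $\mu(U)>0$ for every open neighbourhood $U$ of $x$. For a semigroup $T$, $E(T)=\{x\in T:x^2=x\}$. A semigroup $T$ is simple if it has no ideal (non-empty $I$ with $TI\cup IT\subset I$) other than $T$. An idempotent $e$ of $T$ is primitive if $ex=xe=x\in E(T)$ implies $x=e$. $T$ is completely simple if it is simple and contains a primitive idempotent; in that case every idempotent of $T$ is primitive. The Rees decomposition of a completely simple semigroup $T$ at $e\in E(T)$ is $T=LGR$ with $L=E(Te)$, $G=eTe$, $R=E(eT)$. Here $G$ is a group with identity $e$, called the group factor at $e$, and the product map $L\times G\times R\to T$, $(x,g,y)\mapsto xgy$, is bijective with inverse $z\mapsto(z^L,z^G,z^R)=(ze(eze)^{-1},eze,(eze)^{-1}ez)$. With $T=\mathcal{S}(\mu)$, $\mu^L$ and $\mu^R$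 are the laws under $\mu$ of $z\mapsto z^L$ and $z\mapsto z^R$: $\mu^L(B)=\mu(z: z^L\in B)$ and $\mu^R(B)=\mu(z:z^R\in B)$. Measures on Borel subsets of $S$ are regarded as measures on $S$. *)

theory Defs
  imports "HOL-Probability.Probability" "HOL-Algebra.Group"
begin

text \<open>
  The ambient Polish semigroup \<open>S\<close> is a type of sort
  \<open>{polish_space, topological_semigroup_mult}\<close>: joint continuity of the product is the axiom
  of \<open>topological_semigroup_mult\<close>. The class \<open>polish_space\<close> carries a complete metric, but
  only the topology and the Borel sets it generates are used. Sub-semigroups \<open>T\<close> of \<open>S\<close> are
  sets, and all algebraic notions below are relative to such a \<open>T\<close>.
\<close>

subsection \<open>Completely simple semigroups\<close>

definition subsemigroup :: "'a::semigroup_mult set \<Rightarrow> bool" where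
  "subsemigroup T \<longleftrightarrow> (\<forall>x\<in>T. \<forall>y\<in>T. x * y \<in> T)"

definition idempotents :: "'a::semigroup_mult set \<Rightarrow> 'a set" where
  "idempotents T = {x \<in> T. x * x = x}"

definition semigroup_ideal :: "'a::semigroup_mult set \<Rightarrow> 'a set \<Rightarrow> bool" where
  "semigroup_ideal T I \<longleftrightarrow>
     I \<noteq> {} \<and> I \<subseteq> T \<and> (\<forall>t\<in>T. \<forall>x\<in>I. t * x \<in> I \<and> x * t \<in> I)"

definition simple_semigroup :: "'a::semigroup_mult set \<Rightarrow> bool" where
  "simple_semigroup T \<longleftrightarrow> subsemigroup T \<and> (\<forall>I. semigroup_ideal T I \<longrightarrow> I = T)"

definition primitive_idempotent :: "'a::semigroup_mult set \<Rightarrow> 'a \<Rightarrow> bool" where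
  "primitive_idempotent T e \<longleftrightarrow>
     e \<in> idempotents T \<and> (\<forall>x\<in>idempotents T. e * x = x \<and> x * e = x \<longrightarrow> x = e)"

definition completely_simple :: "'a::semigroup_mult set \<Rightarrow> bool" where
  "completely_simple T \<longleftrightarrow> simple_semigroup T \<and> (\<exists>e. primitive_idempotent T e)"

subsection \<open>Rees decomposition at an idempotent\<close>

definition group_factor :: "'a::semigroup_mult set \<Rightarrow> 'a \<Rightarrow> 'a monoid" where
  "group_factor T e = \<lparr>carrier = {e * t * e | t. t \<in> T}, mult = (*), one = e\<rparr>"

text \<open>
  The coordinates \<open>z\<^sup>L = z e (e z e)\<^sup>-\<^sup>1\<close> and \<open>z\<^sup>R = (e z e)\<^sup>-\<^sup>1 e z\<close>, with the inverse taken in the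
  group factor; they are meaningful for \<open>z \<in> T\<close> only. The factors \<open>L = E(Te)\<close> and
  \<open>R = E(eT)\<close> are their ranges.
\<close>

definition rees_L :: "'a::semigroup_mult set \<Rightarrow> 'a \<Rightarrow> 'a \<Rightarrow> 'a" where
  "rees_L T e z = z * e * inv\<^bsub>group_factor T e\<^esub> (e * z * e)"

definition rees_R :: "'a::semigroup_mult set \<Rightarrow> 'a \<Rightarrow> 'a \<Rightarrow> 'a" where
  "rees_R T e z = inv\<^bsub>group_factor T e\<^esub> (e * z * e) * (e * z)"

subsection \<open>Compact groups and Haar measure\<close>

text \<open>
  The topology on the group is the subspace topology. A compact group inside a Polish space is
  automatically Polish.
\<close>

definition compact_topological_group :: "('a::topological_space) monoid \<Rightarrow> bool" where
  "compact_topological_group G \<longleftrightarrow>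
     group G \<and>
     compact (carrier G) \<and>
     continuous_on (carrier G \<times> carrier G) (\<lambda>(x, y). x \<otimes>\<^bsub>G\<^esub> y) \<and>
     continuous_on (carrier G) (\<lambda>x. inv\<^bsub>G\<^esub> x)"

text \<open>
  The normalized Haar measure is regarded as a Borel measure on the ambient space that is
  concentrated on the group; unimodularity is invariance under both left and right translations.
\<close>

definition normalized_haar :: "('a::topological_space) monoid \<Rightarrow> 'a measure \<Rightarrow> bool" where
  "normalized_haar G \<omega> \<longleftrightarrow>
     prob_space \<omega> \<and> sets \<omega> = sets borel \<and>
     carrier G \<in> sets borel \<and> emeasure \<omega> (carrier G) = 1 \<and>
     (\<forall>g\<in>carrier G. \<forall>B\<in>sets borel. B \<subseteq> carrier G \<longrightarrow>
        emeasure \<omega> ((\<lambda>x. g \<otimes>\<^bsub>G\<^esub> x) ` B) = emeasure \<omega> B \<and>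
        emeasure \<omega> ((\<lambda>x. x \<otimes>\<^bsub>G\<^esub> g) ` B) = emeasure \<omega> B)"

definition haar_measure :: "('a::topological_space) monoid \<Rightarrow> 'a measure" where
  "haar_measure G = (THE \<omega>. normalized_haar G \<omega>)"

subsection \<open>Convolution, support and the laws of the Rees coordinates\<close>

definition mult_convolution ::
  "'a::{polish_space, topological_semigroup_mult} measure \<Rightarrow> 'a measure \<Rightarrow> 'a measure"
  (infixl "\<circledast>" 70) where
  "\<mu> \<circledast> \<nu> = distr (\<mu> \<Otimes>\<^sub>M \<nu>) borel (\<lambda>(x, y). x * y)"

definition topological_support :: "('a::topological_space) measure \<Rightarrow> 'a set" where
  "topological_support \<mu> = {x. \<forall>U. open U \<and> x \<in> U \<longrightarrow> emeasure \<mu> U > 0}"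

text \<open>
  The coordinates are random variables on \<open>T = topological_support \<mu>\<close>, which is closed and has
  full measure, so their laws are push-forwards of the restriction of \<open>\<mu>\<close> to \<open>T\<close>, taken as
  measures on the ambient space.
\<close>

definition law_L :: "('a::{topological_space, semigroup_mult}) measure \<Rightarrow> 'a \<Rightarrow> 'a measure" where
  "law_L \<mu> e =
     distr (restrict_space \<mu> (topological_support \<mu>)) borel (rees_L (topological_support \<mu>) e)"

definition law_R :: "('a::{topological_space, semigroup_mult}) measure \<Rightarrow> 'a \<Rightarrow> 'a measure" where
  "law_R \<mu> e =
     distr (restrict_space \<mu> (topological_support \<mu>)) borel (rees_R (topological_support \<mu>) e)"

text \<open>Evaluating a convolution on a Borel set gives the usual iterated integral.\<close>

lemma emeasure_mult_convolution:
  fixes \<mu> \<nu> :: "'a::{polish_space, topological_semigroup_mult} measure"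
  assumes "prob_space \<mu>" "prob_space \<nu>"
    and \<mu>: "sets \<mu> = sets borel" and \<nu>: "sets \<nu> = sets borel"
    and B: "B \<in> sets borel"
  shows "emeasure (\<mu> \<circledast> \<nu>) B = (\<integral>\<^sup>+ y. \<integral>\<^sup>+ x. indicator B (x * y) \<partial>\<mu> \<partial>\<nu>)"
proof -
  interpret M: prob_space \<mu> by fact
  interpret N: prob_space \<nu> by fact
  interpret pair_sigma_finite \<mu> \<nu> ..
  have s: "sets (\<mu> \<Otimes>\<^sub>M \<nu>) = sets (borel :: ('a \<times> 'a) measure)"
    using sets_pair_measure_cong[OF \<mu> \<nu>] unfolding borel_prod .
  have "continuous_on UNIV (\<lambda>p::'a \<times> 'a. fst p * snd p)"
    by (simp add: continuous_on_def tendsto_mult tendsto_fst tendsto_snd)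
  from borel_measurable_continuous_onI[OF this]
  have m: "(\<lambda>(x, y). x * y) \<in> borel_measurable (\<mu> \<Otimes>\<^sub>M \<nu>)"
    unfolding measurable_cong_sets[OF s refl] case_prod_beta .
  have I: "(indicator B :: 'a \<Rightarrow> ennreal) \<in> borel_measurable borel"
    using B by simp
  have i: "(\<lambda>(x, y). indicator B (x * y) :: ennreal) \<in> borel_measurable (\<mu> \<Otimes>\<^sub>M \<nu>)"
    using measurable_compose[OF m I] by (simp add: case_prod_beta)
  have "emeasure (\<mu> \<circledast> \<nu>) B = (\<integral>\<^sup>+ z. indicator B z \<partial>(\<mu> \<circledast> \<nu>))"
    using B by (simp add: mult_convolution_def)
  also have "\<dots> = (\<integral>\<^sup>+ p. indicator B (fst p * snd p) \<partial>(\<mu> \<Otimes>\<^sub>M \<nu>))"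
    using nn_integral_distr[OF m, of "indicator B"] I by (simp add: mult_convolution_def case_prod_beta)
  also have "\<dots> = (\<integral>\<^sup>+ y. \<integral>\<^sup>+ x. indicator B (x * y) \<partial>\<mu> \<partial>\<nu>)"
    using nn_integral_snd[OF i] by (simp add: case_prod_unfold)
  finally show ?thesis .
qed

end

(*
  For a bounded continuous f put h x = INT z. f (x z) d\<mu>. Idempotence of \<mu> gives INT y. h (x y) d\<mu> = h x,
  so h (x y) - h x has vanishing L2 norm under \<mu> x \<mu>, and by continuity h (x y) = h x on the support T.
  Hence \<delta>_x * \<delta>_y * \<mu> = \<delta>_x * \<mu> for all x, y in T, and dually.

  Consequently \<delta>_x * \<mu> * \<delta>_x is invariant under both translations by elements of its support, the closure
  of x T x. A Polish semigroup carrying such a probability measure is a compact group: tightness yields a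
  point contained in all right ideals x H, which produces units and inverses, and for a sequence h_n and a
  compact K of large measure some k in K satisfies h_n k in K infinitely often. Thus T has idempotents, and e T e
  is a compact group with Haar measure \<delta>_e * \<mu> * \<delta>_e for each of them.

  Since \<mu> * \<delta>_e * \<mu> = \<mu>, the set T e T is dense in T; as z = z e (e z e)^-1 e z is a closed condition valid
  on T e T, it holds on T, and T is completely simple. Finally z^L = z s and z^R = s' z with s, s' in T, so
  absorption turns \<mu> = \<mu> * \<delta>_e * \<mu> * \<delta>_e * \<mu> into the factorization.
*)
theory Submission
  imports Defs
begin

subsection \<open>Borel probability measures on Polish spaces\<close>

text \<open>Indicators of closed sets are pointwise limits of continuous functions with values in
  [0, 1], and the closed sets form an intersection-stable generator of the Borel sets. The bound on
  the test functions supplies the dominating constant 1 here and in later integrals.\<close>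

lemma measure_eqI_continuous:
  fixes M N :: "'a::metric_space measure"
  assumes "prob_space M" "prob_space N"
    and sM: "sets M = sets borel" and sN: "sets N = sets borel"
    and eq: "\<And>f :: 'a \<Rightarrow> real. continuous_on UNIV f \<Longrightarrow> (\<And>x. 0 \<le> f x \<and> f x \<le> 1) \<Longrightarrow>
      (\<integral>x. f x \<partial>M) = (\<integral>x. f x \<partial>N)"
  shows "M = N"
proof -
  interpret M: prob_space M by fact
  interpret N: prob_space N by fact
  have *: "emeasure M C = emeasure N C" if "closed C" for C
  \<comment> \<open>By convention \<open>infdist x {}\<close> is 0, so for empty \<open>C\<close>
    the functions \<open>f n\<close> would be constantly 1 and not converge to the
    indicator.\<close>
  proof (cases "C = {}")
    case False
    define f where "f n x = max 0 (1 - real n * infdist x C)" for n x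
    have cf: "continuous_on UNIV (f n)" for n
      unfolding f_def by (intro continuous_intros)
    have bf: "0 \<le> f n x \<and> f n x \<le> 1" for n x
      unfolding f_def by (auto simp: infdist_nonneg)
    have lim: "(\<lambda>n. f n x) \<longlonglongrightarrow> indicator C x" for x
    proof (cases "x \<in> C")
      case False
      then have p: "infdist x C > 0"
        using in_closed_iff_infdist_zero[OF \<open>closed C\<close> \<open>C \<noteq> {}\<close>] infdist_nonneg[of x C]
        by (metis less_eq_real_def)
      obtain n0 where n0: "1 < real n0 * infdist x C"
        using reals_Archimedean3[OF p] by blast
      have "f n x = 0" if "n \<ge> n0" for n
      proof -
        have "real n0 * infdist x C \<le> real n * infdist x C"
          using that p by (intro mult_right_mono) auto
        then show ?thesis using n0 by (simp add: f_def)
      qed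
      then have "eventually (\<lambda>n. f n x = 0) sequentially"
        using eventually_sequentially by blast
      then show ?thesis using False by (simp add: tendsto_eventually)
    qed (simp add: f_def)
    have L: "(\<lambda>n. \<integral>x. f n x \<partial>K) \<longlonglongrightarrow> measure K C" if "prob_space K" "sets K = sets borel" for K
    proof -
      interpret K: prob_space K by fact
      have m: "g \<in> borel_measurable K" if "g \<in> borel_measurable borel" for g :: "'a \<Rightarrow> real"
        using that measurable_cong_sets[OF \<open>sets K = sets borel\<close> refl] by blast
      have "(\<lambda>n. \<integral>x. f n x \<partial>K) \<longlonglongrightarrow> (\<integral>x. indicator C x \<partial>K)"
        by (rule integral_dominated_convergence[where w="\<lambda>_. 1"])
          (use \<open>closed C\<close> bf lim in \<open>auto intro!: m borel_measurable_continuous_onI[OF cf]\<close>)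
      then show ?thesis
        using \<open>closed C\<close> sets_eq_imp_space_eq[OF \<open>sets K = sets borel\<close>] by simp
    qed
    have "measure M C = measure N C"
      using L[OF assms(1) sM] L[OF assms(2) sN] eq[OF cf bf] LIMSEQ_unique by simp
    then show ?thesis by (simp add: M.emeasure_eq_measure N.emeasure_eq_measure)
  qed simp
  show ?thesis
  proof (rule measure_eqI_generator_eq[where E="Collect closed" and \<Omega>=UNIV and A="\<lambda>_. UNIV"])
    show "sets M = sigma_sets UNIV (Collect closed)" "sets N = sigma_sets UNIV (Collect closed)"
      using sM sN by (simp_all add: borel_eq_closed)
  qed (auto simp: Int_stable_def *)
qed

text \<open>The sort is inherited by products and the Borel sets of a product are generated by
  rectangles, so that \<open>M \<Otimes>\<^sub>M M\<close> is again an instance.\<close>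

locale borel_prob_space = prob_space M for M :: "'a::{complete_space, second_countable_topology} measure" +
  assumes sets_M [simp, measurable_cong]: "sets M = sets borel"
begin

lemma space_M [simp]: "space M = UNIV"
  using sets_eq_imp_space_eq[OF sets_M] by simp

lemma measurable_iff_borel: "f \<in> measurable M N \<longleftrightarrow> f \<in> measurable borel N"
  using measurable_cong_sets[OF sets_M refl] by blast

lemma measurable_continuous:
  fixes f :: "'a \<Rightarrow> 'b::topological_space"
  shows "continuous_on UNIV f \<Longrightarrow> f \<in> M \<rightarrow>\<^sub>M borel"
  by (simp add: measurable_iff_borel borel_measurable_continuous_onI)

lemma borel_prob_space_distr:
  fixes f :: "'a \<Rightarrow> 'b::{complete_space, second_countable_topology}"
  shows "continuous_on UNIV f \<Longrightarrow> borel_prob_space (distr M borel f)"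
  by (intro borel_prob_space.intro borel_prob_space_axioms.intro prob_space_distr
      measurable_continuous) simp_all

lemma integrable_unit_interval:
  fixes f :: "'a \<Rightarrow> real"
  shows "f \<in> borel_measurable M \<Longrightarrow> (\<And>x. 0 \<le> f x \<and> f x \<le> 1) \<Longrightarrow> integrable M f"
  by (rule integrable_const_bound[where B=1]) auto

lemma integral_unit_interval:
  fixes f :: "'a \<Rightarrow> real"
  assumes "f \<in> borel_measurable M" "\<And>x. 0 \<le> f x \<and> f x \<le> 1"
  shows "0 \<le> (\<integral>x. f x \<partial>M) \<and> (\<integral>x. f x \<partial>M) \<le> 1"
  using integral_le_const[OF integrable_unit_interval[OF assms], of 1] assms(2)
  by (simp add: integral_nonneg)

text \<open>Dominated convergence along sequences, with dominating function 1.\<close>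

lemma continuous_on_integral_parametric:
  fixes f :: "'b::metric_space \<Rightarrow> 'a \<Rightarrow> real"
  assumes "\<And>x. f x \<in> borel_measurable M" "\<And>z. continuous_on UNIV (\<lambda>x. f x z)"
    and "\<And>x z. 0 \<le> f x z \<and> f x z \<le> 1"
  shows "continuous_on UNIV (\<lambda>x. \<integral>z. f x z \<partial>M)"
proof (clarsimp simp: continuous_on_sequentially comp_def)
  fix u :: "nat \<Rightarrow> 'b" and a assume u: "u \<longlonglongrightarrow> a"
  show "(\<lambda>n. \<integral>z. f (u n) z \<partial>M) \<longlonglongrightarrow> (\<integral>z. f a z \<partial>M)"
  proof (rule integral_dominated_convergence[where w="\<lambda>_. 1"])
    show "AE z in M. (\<lambda>n. f (u n) z) \<longlonglongrightarrow> f a z"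
      using continuous_on_tendsto_compose[OF assms(2) u] by simp
  qed (use assms in auto)
qed

lemma closed_support: "closed (topological_support M)"
proof -
  have "- topological_support M = \<Union>{U. open U \<and> emeasure M U = 0}"
    by (auto simp: topological_support_def)
  also have "open \<dots>" by auto
  finally show ?thesis by (simp add: closed_def)
qed

text \<open>A null open set is a union of null members of a countable base, so countably many null
  sets cover the complement of the support.\<close>

lemma AE_support: "AE x in M. x \<in> topological_support M"
proof -
  obtain \<B> :: "'a set set" where B: "countable \<B>" "topological_basis \<B>"
    using ex_countable_basis by blast
  have "AE x in M. \<forall>U\<in>{U\<in>\<B>. emeasure M U = 0}. x \<notin> U"
  proof (subst AE_ball_countable)
    show "\<forall>U\<in>{U \<in> \<B>. emeasure M U = 0}. AE x in M. x \<notin> U"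
      using topological_basis_open[OF B(2)] by (auto intro!: AE_not_in null_setsI)
  qed (use B in auto)
  then show ?thesis
  proof eventually_elim
    case (elim x)
    have False if U: "open U" "x \<in> U" "emeasure M U = 0" for U
    proof -
      obtain V where V: "V \<in> \<B>" "x \<in> V" "V \<subseteq> U"
        using topological_basisE[OF B(2) U(1,2)] by blast
      then have "emeasure M V = 0"
        using emeasure_mono[OF V(3), of M] U by auto
      with V elim show False by auto
    qed
    then show ?case unfolding topological_support_def using zero_less_iff_neq_zero by blast
  qed
qed

lemma emeasure_support: "emeasure M (topological_support M) = 1"
  using AE_support closed_support by (simp add: emeasure_eq_1_AE)

lemma support_nonempty: "topological_support M \<noteq> {}"
  using emeasure_support by force

text \<open>The device that upgrades an almost sure identity between continuous maps to an identity
  at every point of the support.\<close>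

lemma support_subset_AE:
  assumes "closed C" "AE x in M. x \<in> C"
  shows "topological_support M \<subseteq> C"
proof -
  have "- C \<in> null_sets M"
    using assms by (intro AE_iff_null_sets[THEN iffD2]) auto
  then show ?thesis
    using \<open>closed C\<close> by (force simp: topological_support_def null_sets_def open_Compl)
qed

text \<open>The closure is needed because the continuous image of a closed set need not be
  closed.\<close>

lemma support_distr:
  fixes f :: "'a \<Rightarrow> 'b::{complete_space, second_countable_topology}"
  assumes f: "continuous_on UNIV f"
  shows "topological_support (distr M borel f) = closure (f ` topological_support M)"
proof
  interpret D: borel_prob_space "distr M borel f" by (rule borel_prob_space_distr[OF f])
  have "AE x in M. f x \<in> closure (f ` topological_support M)"
    using AE_support
    by (rule eventually_mono) (auto intro: closure_subset[THEN subsetD])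
  then show "topological_support (distr M borel f) \<subseteq> closure (f ` topological_support M)"
    by (intro D.support_subset_AE)
      (simp_all add: AE_distr_iff measurable_continuous[OF f])
  have "f x \<in> topological_support (distr M borel f)" if "x \<in> topological_support M" for x
  proof (unfold topological_support_def, clarsimp)
    fix U assume U: "open U" "f x \<in> U"
    have "open (f -` U)" using open_vimage[OF U(1) f] .
    with U that show "0 < emeasure (distr M borel f) U"
      by (auto simp: emeasure_distr measurable_continuous[OF f] topological_support_def)
  qed
  then show "closure (f ` topological_support M) \<subseteq> topological_support (distr M borel f)"
    by (intro closure_minimal D.closed_support) auto
qed

lemma compact_inner_approximation:
  assumes "B \<in> sets borel" "c < measure M B"
  obtains K where "compact K" "K \<subseteq> B" "c < measure M K"
proof -
  have "\<exists>K. K \<subseteq> B \<and> compact K \<and> c < measure M K"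
  \<comment> \<open>Since \<open>ennreal\<close> sends negative reals to 0, the comparison in
    \<open>ennreal\<close> is faithful for nonnegative \<open>c\<close> only; for negative
    \<open>c\<close> the empty set serves.\<close>
  proof (cases "0 \<le> c")
    case True
    then have "ennreal c < emeasure M B"
      using assms by (simp add: emeasure_eq_measure ennreal_less_iff)
    also have "\<dots> = (SUP K \<in> {K. K \<subseteq> B \<and> compact K}. emeasure M K)"
      using assms(1) by (intro inner_regular) simp_all
    finally obtain K where "K \<subseteq> B" "compact K" "ennreal c < emeasure M K"
      unfolding less_SUP_iff by blast
    then show ?thesis using True by (auto simp: emeasure_eq_measure ennreal_less_iff)
  next
    case False
    then show ?thesis by (intro exI[of _ "{}"]) auto
  qed
  with that show ?thesis by blast
qed

end

subsection \<open>Idempotent measures and absorption\<close>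

context borel_prob_space
begin

lemma borel_prob_space_pair: "borel_prob_space (M \<Otimes>\<^sub>M M)"
proof -
  interpret pair_prob_space M M ..
  show ?thesis
    using sets_pair_measure_cong[OF sets_M sets_M] unfolding borel_prod
    by unfold_locales
qed

lemma support_pair:
  assumes "x \<in> topological_support M" "y \<in> topological_support M"
  shows "(x, y) \<in> topological_support (M \<Otimes>\<^sub>M M)"
proof (unfold topological_support_def, clarify)
  interpret P: borel_prob_space "M \<Otimes>\<^sub>M M" by (rule borel_prob_space_pair)
  fix U :: "('a \<times> 'a) set" assume "open U" "(x, y) \<in> U"
  then obtain A B where AB: "open A" "open B" "(x, y) \<in> A \<times> B" "A \<times> B \<subseteq> U"
    by (rule open_prod_elim)
  then have "0 < emeasure M A" "0 < emeasure M B"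
    using assms by (simp_all add: topological_support_def)
  then have "0 < emeasure M A * emeasure M B"
    by (simp add: ennreal_zero_less_mult_iff)
  also have "\<dots> = emeasure (M \<Otimes>\<^sub>M M) (A \<times> B)"
    using AB by (intro emeasure_pair_measure_Times[symmetric]) auto
  also have "\<dots> \<le> emeasure (M \<Otimes>\<^sub>M M) U"
    using \<open>open U\<close> by (intro emeasure_mono AB) (simp only: P.sets_M borel_open)
  finally show "0 < emeasure (M \<Otimes>\<^sub>M M) U" .
qed

lemma AE_mem_ex: "AE x in M. P x \<Longrightarrow> \<exists>x. P x"
  using eventually_happens' ae_filter_bot by blast

end

text \<open>The multiplication is a parameter, so that each one-sided statement also yields its
  left-right dual.\<close>

locale continuous_semigroup =
  fixes m :: "'a::{complete_space, second_countable_topology} \<Rightarrow> 'a \<Rightarrow> 'a" (infixl "\<odot>" 70)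
  assumes continuous_m: "continuous_on UNIV (\<lambda>p. fst p \<odot> snd p)"
    and m_assoc: "x \<odot> y \<odot> z = x \<odot> (y \<odot> z)"
begin

lemma continuous_on_m:
  assumes "continuous_on S f" "continuous_on S g"
  shows "continuous_on S (\<lambda>x. f x \<odot> g x)"
  using continuous_on_compose2[OF continuous_m continuous_on_Pair[OF assms]] by simp

lemma tendsto_m:
  assumes "(f \<longlongrightarrow> a) F" "(g \<longlongrightarrow> b) F"
  shows "((\<lambda>x. f x \<odot> g x) \<longlongrightarrow> a \<odot> b) F"
  using continuous_on_tendsto_compose[OF continuous_m tendsto_Pair[OF assms]] by simp

lemma dual: "continuous_semigroup (\<lambda>x y. y \<odot> x)"
  by unfold_locales
    (simp_all add: m_assoc continuous_on_m continuous_on_fst continuous_on_snd continuous_on_id)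

end

locale idempotent_measure = continuous_semigroup m + borel_prob_space M
  for m :: "'a::{complete_space, second_countable_topology} \<Rightarrow> 'a \<Rightarrow> 'a" (infixl "\<odot>" 70)
    and M :: "'a measure" +
  assumes convolution_idem: "distr (M \<Otimes>\<^sub>M M) borel (\<lambda>(x, y). x \<odot> y) = M"
begin

text \<open>The product measure is invariant under exchanging coordinates, so the opposite
  multiplication has the same convolution square.\<close>

lemma dual_idempotent: "idempotent_measure (\<lambda>x y. y \<odot> x) M"
proof -
  interpret D: continuous_semigroup "\<lambda>x y. y \<odot> x" by (rule dual)
  interpret pair_prob_space M M ..
  interpret P: borel_prob_space "M \<Otimes>\<^sub>M M" by (rule borel_prob_space_pair)
  have "distr (M \<Otimes>\<^sub>M M) borel (\<lambda>(x, y). y \<odot> x) =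
      distr (distr (M \<Otimes>\<^sub>M M) (M \<Otimes>\<^sub>M M) (\<lambda>(x, y). (y, x))) borel (\<lambda>(x, y). x \<odot> y)"
    by (subst distr_distr)
      (auto simp: comp_def case_prod_beta' intro!: P.measurable_continuous continuous_m)
  then show ?thesis
    using distr_pair_swap convolution_idem by unfold_locales simp
qed

lemma integral_convolution:
  fixes f :: "'a \<Rightarrow> real"
  assumes f: "continuous_on UNIV f"
  shows "(\<integral>p. f (fst p \<odot> snd p) \<partial>(M \<Otimes>\<^sub>M M)) = (\<integral>x. f x \<partial>M)"
proof -
  interpret P: borel_prob_space "M \<Otimes>\<^sub>M M" by (rule borel_prob_space_pair)
  show ?thesis
    using integral_distr[OF P.measurable_continuous[OF continuous_m]
      borel_measurable_continuous_onI[OF f]] convolution_idem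
    by (simp add: case_prod_beta')
qed

text \<open>\<open>M\<close> is the image of \<open>M \<Otimes>\<^sub>M M\<close> under
  multiplication, and the support of an image measure contains the image of the support.\<close>

lemma support_mult_closed:
  assumes "x \<in> topological_support M" "y \<in> topological_support M"
  shows "x \<odot> y \<in> topological_support M"
proof -
  interpret P: borel_prob_space "M \<Otimes>\<^sub>M M" by (rule borel_prob_space_pair)
  have "topological_support M = closure ((\<lambda>p. fst p \<odot> snd p) ` topological_support (M \<Otimes>\<^sub>M M))"
    using P.support_distr[OF continuous_m] convolution_idem by (simp add: case_prod_beta')
  then show ?thesis
    using closure_subset[THEN subsetD, OF imageI[OF support_pair[OF assms],
      of "\<lambda>p. fst p \<odot> snd p"]] by simp
qed

text \<open>A Choquet-Deny type argument: for each test function \<open>f\<close> the averaged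
  function \<open>h\<close> is harmonic, and a variance computation forces it to be constant along
  right multiplication by points of the support.\<close>

lemma translate_absorb:
  assumes "x \<in> topological_support M" "y \<in> topological_support M"
  shows "distr M borel ((\<odot>) (x \<odot> y)) = distr M borel ((\<odot>) x)"
proof (rule measure_eqI_continuous)
  have c: "continuous_on UNIV ((\<odot>) a)" for a
    by (intro continuous_on_m continuous_intros)
  show "prob_space (distr M borel ((\<odot>) (x \<odot> y)))" "prob_space (distr M borel ((\<odot>) x))"
    by (intro prob_space_distr measurable_continuous c)+
  fix f :: "'a \<Rightarrow> real" assume f: "continuous_on UNIV f" and f01: "\<And>x. 0 \<le> f x \<and> f x \<le> 1"
  interpret PP: pair_prob_space M M ..
  interpret P: borel_prob_space "M \<Otimes>\<^sub>M M" by (rule borel_prob_space_pair)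
  define h where "h a = (\<integral>z. f (a \<odot> z) \<partial>M)" for a
  have cf: "continuous_on UNIV (\<lambda>z. f (u z))" if "continuous_on UNIV u" for u :: "'b::topological_space \<Rightarrow> 'a"
    by (rule continuous_on_compose2[OF f that]) simp
  have ch: "continuous_on UNIV h"
    unfolding h_def
    by (rule continuous_on_integral_parametric)
      (auto simp: f01 intro!: measurable_continuous cf continuous_on_m continuous_intros)
  have ch': "continuous_on UNIV (\<lambda>z. h (u z))" if "continuous_on UNIV u" for u :: "'b::topological_space \<Rightarrow> 'a"
    by (rule continuous_on_compose2[OF ch that]) simp
  have h01: "0 \<le> h a" "h a \<le> 1" for a
    using integral_unit_interval[of "\<lambda>z. f (a \<odot> z)"] f01 unfolding h_def
    by (auto intro!: measurable_continuous cf c)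
  note cont = cf ch' continuous_on_m continuous_intros continuous_on_fst continuous_on_snd
  \<comment> \<open>Harmonicity of \<open>h\<close>: Fubini merges the two integrations into one
    against the convolution square, which is \<open>M\<close> itself.\<close>
  have hh: "(\<integral>b. h (a \<odot> b) \<partial>M) = h a" for a
  proof -
    have "(\<integral>b. h (a \<odot> b) \<partial>M) = (\<integral>p. f (a \<odot> (fst p \<odot> snd p)) \<partial>(M \<Otimes>\<^sub>M M))"
      unfolding h_def m_assoc
      by (subst PP.integral_fst'[symmetric])
        (auto simp: f01 intro!: P.integrable_unit_interval P.measurable_continuous cont)
    also have "\<dots> = h a"
      unfolding h_def by (rule integral_convolution) (intro cont)
    finally show ?thesis .
  qed
  have i1: "integrable (M \<Otimes>\<^sub>M M) (\<lambda>p. h (fst p \<odot> snd p) * h (fst p \<odot> snd p))"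
    and i2: "integrable (M \<Otimes>\<^sub>M M) (\<lambda>p. h (fst p \<odot> snd p) * h (fst p))"
    and i3: "integrable (M \<Otimes>\<^sub>M M) (\<lambda>p. h (fst p) * h (fst p))"
    by (auto simp: h01 mult_le_one intro!: P.integrable_unit_interval P.measurable_continuous cont)
  \<comment> \<open>Each of the three integrals of the expanded square equals the integral of
    \<open>h a * h a\<close>: the first by idempotence, the mixed one by harmonicity in the second
    coordinate, the last because it ignores the second coordinate. They cancel as 1 - 2 + 1.\<close>
  have "(\<integral>p. (h (fst p \<odot> snd p) - h (fst p))\<^sup>2 \<partial>(M \<Otimes>\<^sub>M M)) =
      (\<integral>p. h (fst p \<odot> snd p) * h (fst p \<odot> snd p) - 2 * (h (fst p \<odot> snd p) * h (fst p))
        + h (fst p) * h (fst p) \<partial>(M \<Otimes>\<^sub>M M))"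
    by (simp add: power2_eq_square algebra_simps)
  also have "\<dots> = (\<integral>p. h (fst p \<odot> snd p) * h (fst p \<odot> snd p) \<partial>(M \<Otimes>\<^sub>M M))
      - 2 * (\<integral>p. h (fst p \<odot> snd p) * h (fst p) \<partial>(M \<Otimes>\<^sub>M M))
      + (\<integral>p. h (fst p) * h (fst p) \<partial>(M \<Otimes>\<^sub>M M))"
    using i1 i2 i3 by simp
  also have "(\<integral>p. h (fst p \<odot> snd p) * h (fst p \<odot> snd p) \<partial>(M \<Otimes>\<^sub>M M)) = (\<integral>a. h a * h a \<partial>M)"
    by (rule integral_convolution[of "\<lambda>a. h a * h a"]) (intro cont)
  also have "(\<integral>p. h (fst p \<odot> snd p) * h (fst p) \<partial>(M \<Otimes>\<^sub>M M)) = (\<integral>a. h a * h a \<partial>M)"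
    using PP.integral_fst'[OF i2] by (simp add: hh)
  also have "(\<integral>p. h (fst p) * h (fst p) \<partial>(M \<Otimes>\<^sub>M M)) = (\<integral>a. h a * h a \<partial>M)"
    using PP.integral_fst'[OF i3] prob_space by simp
  finally have "(\<integral>p. (h (fst p \<odot> snd p) - h (fst p))\<^sup>2 \<partial>(M \<Otimes>\<^sub>M M)) = 0"
    by simp
  moreover have "integrable (M \<Otimes>\<^sub>M M) (\<lambda>p. (h (fst p \<odot> snd p) - h (fst p))\<^sup>2)"
    using i1 i2 i3 by (simp add: power2_eq_square algebra_simps)
  ultimately have "AE p in M \<Otimes>\<^sub>M M. (h (fst p \<odot> snd p) - h (fst p))\<^sup>2 = 0"
    by (subst (asm) integral_nonneg_eq_0_iff_AE) auto
  then have "AE p in M \<Otimes>\<^sub>M M. p \<in> {p. h (fst p \<odot> snd p) = h (fst p)}"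
    by simp
  \<comment> \<open>Continuity of \<open>h\<close> makes the set of equality closed, so it contains
    the whole support of the product measure, in particular \<open>(x, y)\<close>.\<close>
  then have "topological_support (M \<Otimes>\<^sub>M M) \<subseteq> {p. h (fst p \<odot> snd p) = h (fst p)}"
    by (intro P.support_subset_AE closed_Collect_eq cont)
  then have "h (x \<odot> y) = h x"
    using support_pair[OF assms] by auto
  then show "(\<integral>x. f x \<partial>distr M borel ((\<odot>) (x \<odot> y))) = (\<integral>xa. f xa \<partial>distr M borel ((\<odot>) x))"
    by (simp add: h_def integral_distr[OF measurable_continuous[OF c]
      borel_measurable_continuous_onI[OF f]])
qed simp_all

end

text \<open>Each test function imposes a closed condition on \<open>a\<close>, because its integral
  against the translate depends continuously on \<open>a\<close>. This extends invariance from a set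
  of translations to its closure.\<close>

lemma (in continuous_semigroup) closed_translates:
  assumes "borel_prob_space M" "borel_prob_space N"
  shows "closed {a. distr M borel ((\<odot>) a) = N}"
proof -
  interpret M: borel_prob_space M by fact
  interpret N: borel_prob_space N by fact
  have c: "continuous_on UNIV ((\<odot>) a)" for a
    by (intro continuous_on_m continuous_intros)
  define F where "F = {f :: 'a \<Rightarrow> real. continuous_on UNIV f \<and> (\<forall>x. 0 \<le> f x \<and> f x \<le> 1)}"
  have int: "(\<integral>x. f x \<partial>distr M borel ((\<odot>) a)) = (\<integral>z. f (a \<odot> z) \<partial>M)" if "f \<in> F" for f a
    by (rule integral_distr)
      (use that in \<open>auto simp: F_def intro!: M.measurable_continuous c borel_measurable_continuous_onI\<close>)
  have "distr M borel ((\<odot>) a) = N \<longleftrightarrow>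
      (\<forall>f\<in>F. (\<integral>z. f (a \<odot> z) \<partial>M) = (\<integral>z. f z \<partial>N))" for a
  proof
    assume "distr M borel ((\<odot>) a) = N"
    with int[of _ a] show "\<forall>f\<in>F. (\<integral>z. f (a \<odot> z) \<partial>M) = (\<integral>z. f z \<partial>N)"
      by simp
  next
    assume "\<forall>f\<in>F. (\<integral>z. f (a \<odot> z) \<partial>M) = (\<integral>z. f z \<partial>N)"
    then show "distr M borel ((\<odot>) a) = N"
      using int[of _ a]
      by (intro measure_eqI_continuous N.prob_space_axioms M.prob_space_distr
          M.measurable_continuous c) (simp_all add: F_def)
  qed
  then have "{a. distr M borel ((\<odot>) a) = N} = (\<Inter>f\<in>F. {a. (\<integral>z. f (a \<odot> z) \<partial>M) = (\<integral>z. f z \<partial>N)})"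
    by (simp add: set_eq_iff)
  also have "closed \<dots>"
  proof (intro closed_INT ballI closed_Collect_eq continuous_on_const M.continuous_on_integral_parametric)
    fix f a assume f: "f \<in> F"
    then have cf: "continuous_on UNIV f" by (simp add: F_def)
    show "(\<lambda>z. f (a \<odot> z)) \<in> borel_measurable M"
      by (intro M.measurable_continuous continuous_on_compose2[OF cf c]) simp
    show "continuous_on UNIV (\<lambda>x. f (x \<odot> a))"
      by (intro continuous_on_compose2[OF cf] continuous_on_m continuous_intros) simp
    show "0 \<le> f (x \<odot> a) \<and> f (x \<odot> a) \<le> 1" for x
      using f by (simp add: F_def)
  qed
  finally show ?thesis .
qed

subsection \<open>Invariant measures on closed subsemigroups\<close>

text \<open>No identity or inverses are assumed. The inclusion of \<open>H\<close> in the support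
  lets closed almost sure statements spread to every point of \<open>H\<close>.\<close>

locale invariant_measure = continuous_semigroup m + borel_prob_space M
  for m :: "'a::{complete_space, second_countable_topology} \<Rightarrow> 'a \<Rightarrow> 'a" (infixl "\<odot>" 70)
    and M :: "'a measure" +
  fixes H :: "'a set"
  assumes closed_H: "closed H"
    and m_closed: "x \<in> H \<Longrightarrow> y \<in> H \<Longrightarrow> x \<odot> y \<in> H"
    and AE_H: "AE x in M. x \<in> H"
    and H_subset_support: "H \<subseteq> topological_support M"
    and left_invariant: "x \<in> H \<Longrightarrow> distr M borel ((\<odot>) x) = M"
    and right_invariant: "x \<in> H \<Longrightarrow> distr M borel (\<lambda>z. z \<odot> x) = M"
begin

lemma dual_invariant: "invariant_measure (\<lambda>x y. y \<odot> x) M H"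
proof -
  interpret D: continuous_semigroup "\<lambda>x y. y \<odot> x" by (rule dual)
  show ?thesis
    using closed_H m_closed AE_H H_subset_support left_invariant right_invariant
    by unfold_locales auto
qed

lemma continuous_translate:
  "continuous_on UNIV ((\<odot>) x)" "continuous_on UNIV (\<lambda>z. z \<odot> x)"
  by (intro continuous_on_m continuous_on_id continuous_on_const)+

lemma AE_left_translate:
  assumes "x \<in> H" "B \<in> sets borel"
  shows "(AE z in M. x \<odot> z \<in> B) \<longleftrightarrow> (AE z in M. z \<in> B)"
  using AE_distr_iff[OF measurable_continuous[OF continuous_translate(1)], of "\<lambda>z. z \<in> B" x] assms(2)
  unfolding left_invariant[OF assms(1)] by simp

lemma AE_right_translate:
  assumes "x \<in> H" "B \<in> sets borel"
  shows "(AE z in M. z \<odot> x \<in> B) \<longleftrightarrow> (AE z in M. z \<in> B)"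
  using AE_distr_iff[OF measurable_continuous[OF continuous_translate(2)], of "\<lambda>z. z \<in> B" x] assms(2)
  unfolding right_invariant[OF assms(1)] by simp

lemma prob_H: "prob H = 1"
  using AE_H closed_H by (subst prob_eq_1) auto

text \<open>Inner regularity with error 1 / (n + 1). Compact pieces are wanted because their
  continuous images are again compact, hence Borel, whereas images of general Borel sets need not be
  Borel.\<close>

lemma sigma_compact_full:
  "\<exists>K :: nat \<Rightarrow> 'a set. (\<forall>n. compact (K n) \<and> K n \<subseteq> H) \<and> (AE x in M. x \<in> (\<Union>n. K n))"
proof -
  have "\<exists>K. compact K \<and> K \<subseteq> H \<and> 1 - 1 / real (Suc n) < prob K" for n
    by (rule compact_inner_approximation[of H "1 - 1 / real (Suc n)"])
      (auto simp: closed_H prob_H)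
  then obtain K where K: "\<And>n. compact (K n)" "\<And>n. K n \<subseteq> H"
      "\<And>n. 1 - 1 / real (Suc n) < prob (K n)"
    by metis
  have meas: "(\<Union>n. K n) \<in> sets borel"
    using K(1) by (auto intro: borel_closed compact_imp_closed)
  have "1 - 1 / real (Suc n) \<le> prob (\<Union>n. K n)" for n
    using K(3)[of n] finite_measure_mono[of "K n" "\<Union>n. K n"] meas by force
  moreover have "(\<lambda>n. 1 - 1 / real (Suc n)) \<longlonglongrightarrow> 1 - 0"
    using LIMSEQ_inverse_real_of_nat by (intro tendsto_diff tendsto_const) (simp add: inverse_eq_divide)
  ultimately have "1 \<le> prob (\<Union>n. K n)"
    using LIMSEQ_le_const2[of _ "1 - 0" "prob (\<Union>n. K n)"] by auto
  then have "prob (\<Union>n. K n) = 1"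
    using prob_le_1[of "\<Union>n. K n"] by linarith
  then have "AE x in M. x \<in> (\<Union>n. K n)"
    by (rule AE_prob_1)
  with K show ?thesis by blast
qed

text \<open>The set of all \<open>(x, x \<odot> y)\<close> with \<open>x, y\<close> in a full \<open>\<sigma>\<close>-compact set is Borel and, by
  invariance, has full measure.  Exchanging the order of the two coordinates yields a single point
  \<open>z\<close> lying in almost every right ideal \<open>x \<odot> H\<close>, hence in every one.\<close>

lemma ex_in_all_right_ideals:
  obtains z where "z \<in> H" "\<And>x. x \<in> H \<Longrightarrow> \<exists>u\<in>H. z = x \<odot> u"
proof -
  obtain K :: "nat \<Rightarrow> 'a set"
    where "\<forall>n. compact (K n) \<and> K n \<subseteq> H" and AE_K: "AE x in M. x \<in> (\<Union>n. K n)"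
    using sigma_compact_full by blast
  then have K: "compact (K n)" "K n \<subseteq> H" for n
    by auto
  interpret pair_prob_space M M ..
  interpret P: borel_prob_space "M \<Otimes>\<^sub>M M" by (rule borel_prob_space_pair)
  define \<phi> where "\<phi> p = (fst p, fst p \<odot> snd p)" for p
  define P where "P = (\<Union>n k. \<phi> ` (K n \<times> K k))"
  have "continuous_on UNIV \<phi>"
    unfolding \<phi>_def
    by (intro continuous_on_Pair continuous_on_m continuous_on_fst continuous_on_snd continuous_on_id)
  then have "compact (\<phi> ` (K n \<times> K k))" for n k
    by (intro compact_continuous_image compact_Times K(1)) (rule continuous_on_subset, auto)
  then have "\<phi> ` (K n \<times> K k) \<in> sets borel" for n k
    by (intro borel_closed compact_imp_closed)
  then have P: "P \<in> sets borel"
    unfolding P_def by (intro sets.countable_UN image_subsetI)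
  have "{z. (x, z) \<in> P} = Pair x -` P \<inter> space borel" for x
    by auto
  also have "\<dots> x \<in> sets borel" for x
    by (intro measurable_sets[OF _ P] borel_measurable_continuous_onI continuous_on_Pair
        continuous_on_id continuous_on_const)
  finally have sec1: "{z. (x, z) \<in> P} \<in> sets borel" for x .
  have "{x. (x, z) \<in> P} = (\<lambda>x. (x, z)) -` P \<inter> space borel" for z
    by auto
  also have "\<dots> z \<in> sets borel" for z
    by (intro measurable_sets[OF _ P] borel_measurable_continuous_onI continuous_on_Pair
        continuous_on_id continuous_on_const)
  finally have sec2: "{x. (x, z) \<in> P} \<in> sets borel" for z .
  have "AE z in M. (x, z) \<in> P" if x: "x \<in> (\<Union>n. K n)" for x
  proof -
    from x K(2) have "x \<in> H" by blast
    have "AE y in M. (x, x \<odot> y) \<in> P"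
      using AE_K
    proof (rule eventually_mono)
      fix y assume "y \<in> (\<Union>n. K n)"
      with x obtain n k where "(x, y) \<in> K n \<times> K k" by blast
      then have "\<phi> (x, y) \<in> P" unfolding P_def by blast
      then show "(x, x \<odot> y) \<in> P" by (simp add: \<phi>_def)
    qed
    then show ?thesis
      using AE_left_translate[OF \<open>x \<in> H\<close> sec1[of x]] by simp
  qed
  then have "AE x in M. AE z in M. (x, z) \<in> P"
    using AE_K by (rule eventually_mono[rotated])
  then have "AE z in M. AE x in M. (x, z) \<in> P"
    using P by (subst (asm) AE_commute) (simp_all only: P.space_M P.sets_M prod.collapse UNIV_I simp_thms Collect_mem_eq)
  with AE_H have "AE z in M. z \<in> H \<and> (AE x in M. (x, z) \<in> P)"
    by eventually_elim simp
  then obtain z where z: "z \<in> H" "AE x in M. (x, z) \<in> P"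
    using AE_mem_ex by blast
  have PH: "\<exists>u\<in>H. b = a \<odot> u" if "(a, b) \<in> P" for a b
    using that K(2) unfolding P_def \<phi>_def by force
  \<comment> \<open>To pass from almost every right ideal to a given one, translate by
    \<open>x\<close>: some \<open>x \<odot> y\<close> belongs to the full set, and its right ideal
    is contained in that of \<open>x\<close>.\<close>
  have "\<exists>u\<in>H. z = x \<odot> u" if x: "x \<in> H" for x
  proof -
    have "AE y in M. (x \<odot> y, z) \<in> P"
      using AE_left_translate[OF x sec2[of z]] z(2) by simp
    with AE_H have "AE y in M. y \<in> H \<and> (x \<odot> y, z) \<in> P"
      by eventually_elim simp
    then obtain y where y: "y \<in> H" "(x \<odot> y, z) \<in> P"
      using AE_mem_ex by blast
    with PH obtain u where "u \<in> H" "z = x \<odot> y \<odot> u" by blast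
    with y show ?thesis by (auto simp: m_assoc intro: m_closed)
  qed
  with z(1) that show thesis by blast
qed

text \<open>The common point \<open>z\<close> lies in the right ideal of \<open>z \<odot> x\<close>,
  so \<open>z = z \<odot> x \<odot> u\<close>. Hence \<open>x \<odot> u\<close> fixes every
  \<open>s \<odot> z\<close> from the right. By right invariance almost every point is then fixed,
  and being fixed is a closed condition.\<close>

lemma right_ideal_contains_right_unit:
  assumes x: "x \<in> H"
  obtains u where "u \<in> H" "\<And>t. t \<in> H \<Longrightarrow> t \<odot> (x \<odot> u) = t"
proof -
  obtain z where z: "z \<in> H" "\<And>x. x \<in> H \<Longrightarrow> \<exists>u\<in>H. z = x \<odot> u"
    by (rule ex_in_all_right_ideals) blast
  obtain u where u: "u \<in> H" "z = z \<odot> x \<odot> u"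
    using z(2)[OF m_closed[OF z(1) x]] by blast
  define C where "C = {t. t \<odot> (x \<odot> u) = t}"
  have "closed C"
    unfolding C_def by (intro closed_Collect_eq continuous_translate continuous_on_id)
  have "s \<odot> z \<in> C" for s
    using u(2) by (simp add: C_def m_assoc)
  then have "AE t in M. t \<in> C"
    using AE_right_translate[OF z(1) borel_closed[OF \<open>closed C\<close>]] by simp
  then have "H \<subseteq> C"
    using support_subset_AE[OF \<open>closed C\<close>] H_subset_support by blast
  with u(1) that show thesis by (auto simp: C_def)
qed

text \<open>Each right ideal \<open>x \<odot> H\<close> contains a right unit and, by duality, each
  left ideal \<open>H \<odot> x\<close> a left unit. A left unit and a right unit always coincide,
  so all of them equal one \<open>e\<close>, which gives one-sided inverses on both sides.\<close>

lemma group: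
  obtains e where "e \<in> H" "\<And>x. x \<in> H \<Longrightarrow> e \<odot> x = x" "\<And>x. x \<in> H \<Longrightarrow> x \<odot> e = x"
    "\<And>x. x \<in> H \<Longrightarrow> \<exists>y\<in>H. x \<odot> y = e \<and> y \<odot> x = e"
proof -
  interpret D: invariant_measure "\<lambda>x y. y \<odot> x" M H by (rule dual_invariant)
  obtain x0 where x0: "x0 \<in> H" using AE_mem_ex[OF AE_H] by blast
  obtain u0 where u0: "u0 \<in> H" "\<And>t. t \<in> H \<Longrightarrow> t \<odot> (x0 \<odot> u0) = t"
    by (rule right_ideal_contains_right_unit[OF x0]) blast
  define e where "e = x0 \<odot> u0"
  have e: "e \<in> H" "\<And>t. t \<in> H \<Longrightarrow> t \<odot> e = t"
    using u0 x0 by (auto simp: e_def m_closed)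
  have left: "\<exists>v\<in>H. v \<odot> x = e \<and> (\<forall>t\<in>H. e \<odot> t = t)" if x: "x \<in> H" for x
  proof -
    obtain v where v: "v \<in> H" "\<And>t. t \<in> H \<Longrightarrow> v \<odot> x \<odot> t = t"
      by (rule D.right_ideal_contains_right_unit[OF x]) blast
    have "v \<odot> x = e"
      using v(2)[OF e(1)] e(2)[OF m_closed[OF v(1) x]] by simp
    with v show ?thesis by auto
  qed
  then have e': "e \<odot> t = t" if "t \<in> H" for t
    using x0 that by blast
  have right: "\<exists>u\<in>H. x \<odot> u = e" if x: "x \<in> H" for x
  proof -
    obtain u where u: "u \<in> H" "\<And>t. t \<in> H \<Longrightarrow> t \<odot> (x \<odot> u) = t"
      by (rule right_ideal_contains_right_unit[OF x]) blast
    have "x \<odot> u = e"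
      using u(2)[OF e(1)] e'[OF m_closed[OF x u(1)]] by simp
    with u(1) show ?thesis by blast
  qed
  have "\<exists>y\<in>H. x \<odot> y = e \<and> y \<odot> x = e" if x: "x \<in> H" for x
  proof -
    obtain u v where uv: "u \<in> H" "v \<in> H" "x \<odot> u = e" "v \<odot> x = e"
      using left[OF x] right[OF x] by blast
    have "v = v \<odot> (x \<odot> u)" using uv e(2) by simp
    also have "\<dots> = v \<odot> x \<odot> u" by (simp only: m_assoc)
    also have "\<dots> = u" using uv e' by simp
    finally show ?thesis using uv by blast
  qed
  with e e' that show thesis by blast
qed

text \<open>If \<open>K\<close> has measure above \<open>3/4\<close>, the sets \<open>{k \<in> K. h n \<odot> k \<in> K}\<close> have measure at least
  \<open>1/2\<close>, so some \<open>k\<close> lies in infinitely many of them; along that subsequence \<open>h n\<close> stays in the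
  compact set \<open>K \<odot> k\<^sup>-\<^sup>1\<close>.\<close>

lemma compact_H: "compact H"
proof -
  obtain e where e: "e \<in> H" "\<And>x. x \<in> H \<Longrightarrow> e \<odot> x = x" "\<And>x. x \<in> H \<Longrightarrow> x \<odot> e = x"
    "\<And>x. x \<in> H \<Longrightarrow> \<exists>y\<in>H. x \<odot> y = e \<and> y \<odot> x = e"
    by (rule group) blast
  obtain K where K: "compact K" "K \<subseteq> H" "3 / 4 < prob K"
    by (rule compact_inner_approximation[of H "3 / 4"]) (simp_all add: closed_H prob_H)
  have K': "closed K" using K(1) by (rule compact_imp_closed)
  have "seq_compact H"
  proof (rule seq_compactI)
    fix h :: "nat \<Rightarrow> 'a" assume h: "\<forall>n. h n \<in> H"
    define B where "B n = K \<inter> (\<odot>) (h n) -` K" for n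
    have cl: "closed (B n)" "closed ((\<odot>) (h n) -` K)" for n
      unfolding B_def using K' continuous_translate(1)
      by (auto intro!: closed_Int continuous_closed_vimage simp: continuous_on_eq_continuous_at)
    \<comment> \<open>Both \<open>K\<close> and its preimage under translation by \<open>h n\<close>
      have measure above 3/4, while their union has measure at most 1.\<close>
    have half: "1 / 2 \<le> prob (B n)" for n
    proof -
      have "prob ((\<odot>) (h n) -` K) = measure (distr M borel ((\<odot>) (h n))) K"
        using K' by (simp add: measure_distr measurable_continuous continuous_translate)
      then have "prob ((\<odot>) (h n) -` K) = prob K"
        using h left_invariant by simp
      moreover have "prob (K \<union> (\<odot>) (h n) -` K) = prob K + prob ((\<odot>) (h n) -` K) - prob (B n)"
        unfolding B_def using K' cl(2) by (intro measure_Un3 fmeasurableI) (auto simp: emeasure_eq_measure)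
      ultimately show ?thesis
        using K(3) prob_le_1[of "K \<union> (\<odot>) (h n) -` K"] by linarith
    qed
    \<comment> \<open>The intersection of the decreasing sets \<open>C n\<close> consists of the
      points lying in infinitely many \<open>B i\<close>; continuity from above keeps its measure at
      least 1/2.\<close>
    define C where "C n = (\<Union>i\<in>{n..}. B i)" for n
    have C: "C n \<in> sets borel" for n
      unfolding C_def using cl(1) by (auto intro: borel_closed)
    have "(\<lambda>n. prob (C n)) \<longlonglongrightarrow> prob (\<Inter>n. C n)"
    proof (intro finite_Lim_measure_decseq)
      show "decseq C"
        unfolding decseq_def C_def by (intro allI impI UN_mono) auto
    qed (use C in auto)
    moreover have "1 / 2 \<le> prob (C n)" for n
      using half[of n] finite_measure_mono[of "B n" "C n"] C by (force simp: C_def)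
    ultimately have "1 / 2 \<le> prob (\<Inter>n. C n)"
      by (intro LIMSEQ_le_const) auto
    then have "(\<Inter>n. C n) \<noteq> {}" by auto
    then obtain k where "k \<in> (\<Inter>n. C n)" by blast
    then have "\<forall>n. \<exists>i\<ge>n. k \<in> B i"
      by (auto simp: C_def)
    then have "infinite {i. k \<in> B i}"
      unfolding infinite_nat_iff_unbounded_le by auto
    then obtain r :: "nat \<Rightarrow> nat" where r: "strict_mono r" "\<And>n. k \<in> B (r n)"
      using infinite_enumerate by blast
    then have "k \<in> H" "\<forall>n. h (r n) \<odot> k \<in> K"
      using K(2) by (auto simp: B_def)
    then obtain l s where s: "strict_mono (s :: nat \<Rightarrow> nat)" "l \<in> K"
        "((\<lambda>n. h (r n) \<odot> k) \<circ> s) \<longlonglongrightarrow> l"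
      using K(1) unfolding compact_eq_seq_compact_metric seq_compact_def by metis
    obtain y where y: "y \<in> H" "k \<odot> y = e"
      using e(4) \<open>k \<in> H\<close> by blast
    have "(\<lambda>n. h (r (s n)) \<odot> k \<odot> y) \<longlonglongrightarrow> l \<odot> y"
      using s(3) by (intro tendsto_m tendsto_const) (simp add: comp_def)
    then have "(h \<circ> (r \<circ> s)) \<longlonglongrightarrow> l \<odot> y"
      using h e(3) by (simp add: m_assoc y comp_def)
    moreover have "l \<odot> y \<in> H"
      using s(2) K(2) y m_closed by blast
    ultimately show "\<exists>l\<in>H. \<exists>r. strict_mono (r :: nat \<Rightarrow> nat) \<and> (h \<circ> r) \<longlonglongrightarrow> l"
      using strict_mono_o[OF r(1) s(1)] by blast
  qed
  then show ?thesis
    by (simp add: compact_eq_seq_compact_metric)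
qed

end

subsection \<open>Push-forwards of product measures\<close>

text \<open>By Tonelli the law of \<open>f\<close> is the average over \<open>x\<close> of the laws
  of its sections, so comparing almost all sections suffices. In this way absorption at points of
  the support becomes an identity between convolutions.\<close>

lemma distr_pair_cong_snd:
  fixes M :: "'a::{complete_space, second_countable_topology} measure"
    and N :: "'b::{complete_space, second_countable_topology} measure"
  assumes "borel_prob_space M" "borel_prob_space N"
    and f: "f \<in> M \<Otimes>\<^sub>M N \<rightarrow>\<^sub>M K" and g: "g \<in> M \<Otimes>\<^sub>M N \<rightarrow>\<^sub>M K"
    and eq: "AE x in M. distr N K (\<lambda>y. f (x, y)) = distr N K (\<lambda>y. g (x, y))"
  shows "distr (M \<Otimes>\<^sub>M N) K f = distr (M \<Otimes>\<^sub>M N) K g"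
proof (rule measure_eqI)
  interpret M: borel_prob_space M by fact
  interpret N: borel_prob_space N by fact
  fix B assume "B \<in> sets (distr (M \<Otimes>\<^sub>M N) K f)"
  then have B: "B \<in> sets K" by simp
  have iter: "emeasure (distr (M \<Otimes>\<^sub>M N) K h) B = (\<integral>\<^sup>+ x. emeasure (distr N K (\<lambda>y. h (x, y))) B \<partial>M)"
    if h: "h \<in> M \<Otimes>\<^sub>M N \<rightarrow>\<^sub>M K" for h
  proof -
    have "emeasure (distr (M \<Otimes>\<^sub>M N) K h) B = emeasure (M \<Otimes>\<^sub>M N) (h -` B \<inter> space (M \<Otimes>\<^sub>M N))"
      by (rule emeasure_distr[OF h B])
    also have "\<dots> = (\<integral>\<^sup>+ x. emeasure N (Pair x -` (h -` B \<inter> space (M \<Otimes>\<^sub>M N))) \<partial>M)"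
      by (rule N.emeasure_pair_measure_alt[OF measurable_sets[OF h B]])
    also have "\<dots> = (\<integral>\<^sup>+ x. emeasure (distr N K (\<lambda>y. h (x, y))) B \<partial>M)"
    proof (rule nn_integral_cong)
      fix x assume x: "x \<in> space M"
      have "Pair x -` (h -` B \<inter> space (M \<Otimes>\<^sub>M N)) = (\<lambda>y. h (x, y)) -` B \<inter> space N"
        by (auto simp: space_pair_measure)
      then show "emeasure N (Pair x -` (h -` B \<inter> space (M \<Otimes>\<^sub>M N))) = emeasure (distr N K (\<lambda>y. h (x, y))) B"
        using emeasure_distr[OF measurable_Pair2[OF h x] B] by simp
    qed
    finally show ?thesis .
  qed
  show "emeasure (distr (M \<Otimes>\<^sub>M N) K f) B = emeasure (distr (M \<Otimes>\<^sub>M N) K g) B"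
    unfolding iter[OF f] iter[OF g]
    by (rule nn_integral_cong_AE) (use eq in \<open>auto elim: eventually_mono\<close>)
qed simp

lemma distr_pair_cong_fst:
  fixes M :: "'a::{complete_space, second_countable_topology} measure"
    and N :: "'b::{complete_space, second_countable_topology} measure"
  assumes "borel_prob_space M" "borel_prob_space N"
    and f: "f \<in> M \<Otimes>\<^sub>M N \<rightarrow>\<^sub>M K" and g: "g \<in> M \<Otimes>\<^sub>M N \<rightarrow>\<^sub>M K"
    and eq: "AE y in N. distr M K (\<lambda>x. f (x, y)) = distr M K (\<lambda>x. g (x, y))"
  shows "distr (M \<Otimes>\<^sub>M N) K f = distr (M \<Otimes>\<^sub>M N) K g"
proof -
  interpret M: borel_prob_space M by fact
  interpret N: borel_prob_space N by fact
  interpret pair_prob_space M N ..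
  have swap: "distr (M \<Otimes>\<^sub>M N) K h = distr (N \<Otimes>\<^sub>M M) K (\<lambda>(y, x). h (x, y))"
    if "h \<in> M \<Otimes>\<^sub>M N \<rightarrow>\<^sub>M K" for h
    by (subst distr_pair_swap, subst distr_distr[OF that measurable_pair_swap'])
      (simp add: comp_def case_prod_beta')
  show ?thesis
    unfolding swap[OF f] swap[OF g]
    by (rule distr_pair_cong_snd) (use assms in \<open>auto intro: measurable_pair_swap\<close>)
qed

text \<open>Replaces a map that is controlled only on a full set by a map measurable on the whole
  space, as needed for the Rees coordinates.\<close>

lemma distr_restrict_space_full:
  assumes "S \<in> sets M" "AE x in M. x \<in> S"
    and f: "f \<in> M \<rightarrow>\<^sub>M N" and eq: "\<And>x. x \<in> S \<Longrightarrow> g x = f x"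
  shows "distr (restrict_space M S) N g = distr M N f"
proof (rule measure_eqI)
  fix B assume "B \<in> sets (distr (restrict_space M S) N g)"
  then have B: "B \<in> sets N" by simp
  have S: "S \<subseteq> space M" using assms(1) sets.sets_into_space by blast
  have "g \<in> restrict_space M S \<rightarrow>\<^sub>M N"
    using measurable_restrict_space1[OF f, of S] measurable_cong[of "restrict_space M S" g f N] eq
    by (simp add: space_restrict_space)
  then have "emeasure (distr (restrict_space M S) N g) B = emeasure (restrict_space M S) (g -` B \<inter> S)"
    using B S by (simp add: emeasure_distr space_restrict_space Int_absorb2)
  also have "g -` B \<inter> S = (f -` B \<inter> space M) \<inter> S"
    using eq S by auto
  also have "emeasure (restrict_space M S) \<dots> = emeasure M ((f -` B \<inter> space M) \<inter> S)"
    using assms(1) S by (intro emeasure_restrict_space) auto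
  also have "\<dots> = emeasure M (f -` B \<inter> space M)"
    using measurable_sets[OF f B] assms(1,2) by (intro emeasure_eq_AE) auto
  also have "\<dots> = emeasure (distr M N f) B"
    using f B by (simp add: emeasure_distr)
  finally show "emeasure (distr (restrict_space M S) N g) B = emeasure (distr M N f) B" .
qed simp

section \<open>Measurability of products and convolutions of image measures\<close>

lemma continuous_on_mult_semigroup:
  fixes f g :: "'b::topological_space \<Rightarrow> 'a::topological_semigroup_mult"
  shows "continuous_on S f \<Longrightarrow> continuous_on S g \<Longrightarrow> continuous_on S (\<lambda>x. f x * g x)"
  by (simp add: continuous_on_def tendsto_mult)

lemma measurable_mult_pair:
  fixes M N :: "'a::{polish_space, topological_semigroup_mult} measure"
  assumes "sets M = sets borel" "sets N = sets borel"
  shows "(\<lambda>p. fst p * snd p) \<in> M \<Otimes>\<^sub>M N \<rightarrow>\<^sub>M borel"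
proof -
  have "(\<lambda>p :: 'a \<times> 'a. fst p * snd p) \<in> borel \<rightarrow>\<^sub>M borel"
    by (intro borel_measurable_continuous_onI continuous_on_mult_semigroup continuous_on_fst
        continuous_on_snd continuous_on_id)
  then show ?thesis
    using measurable_cong_sets[OF sets_pair_measure_cong[OF assms] refl, of borel]
    unfolding borel_prod by blast
qed

lemma measurable_mult:
  fixes f g :: "'b \<Rightarrow> 'a::{polish_space, topological_semigroup_mult}"
  assumes "f \<in> M \<rightarrow>\<^sub>M borel" "g \<in> M \<rightarrow>\<^sub>M borel"
  shows "(\<lambda>x. f x * g x) \<in> M \<rightarrow>\<^sub>M borel"
  using measurable_compose[OF measurable_Pair[OF assms] measurable_mult_pair[OF refl refl]] by simp

lemma mult_convolution_distr_left:
  fixes N :: "'a::{polish_space, topological_semigroup_mult} measure"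
  assumes f: "f \<in> M \<rightarrow>\<^sub>M borel" and "prob_space N" and N: "sets N = sets borel"
  shows "distr M borel f \<circledast> N = distr (M \<Otimes>\<^sub>M N) borel (\<lambda>p. f (fst p) * snd p)"
proof -
  have "distr M borel f \<Otimes>\<^sub>M N = distr (M \<Otimes>\<^sub>M N) (borel \<Otimes>\<^sub>M N) (\<lambda>(x, y). (f x, y))"
    using pair_measure_distr[OF f measurable_ident_sets[OF refl, of N]] assms(2)
    by (simp add: prob_space_imp_sigma_finite distr_id)
  then show ?thesis
    unfolding mult_convolution_def
    using f N measurable_mult_pair[OF refl N]
    by (simp add: distr_distr comp_def case_prod_beta')
qed

lemma mult_convolution_distr_right:
  fixes N :: "'a::{polish_space, topological_semigroup_mult} measure"
  assumes f: "f \<in> M \<rightarrow>\<^sub>M borel" and "prob_space M" and N: "sets N = sets borel"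
  shows "N \<circledast> distr M borel f = distr (N \<Otimes>\<^sub>M M) borel (\<lambda>p. fst p * f (snd p))"
proof -
  have "N \<Otimes>\<^sub>M distr M borel f = distr (N \<Otimes>\<^sub>M M) (N \<Otimes>\<^sub>M borel) (\<lambda>(x, y). (x, f y))"
    using pair_measure_distr[OF measurable_ident_sets[OF refl, of N] f]
      prob_space.prob_space_distr[OF assms(2) f]
    by (simp add: prob_space_imp_sigma_finite distr_id)
  then show ?thesis
    unfolding mult_convolution_def
    using f N measurable_mult_pair[OF N refl]
    by (simp add: distr_distr comp_def case_prod_beta')
qed

subsection \<open>The support of an idempotent measure\<close>

locale convolution_idempotent = idempotent_measure "(*)" M
  for M :: "'a::{polish_space, topological_semigroup_mult} measure"
begin

abbreviation T :: "'a set" where "T \<equiv> topological_support M"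

lemma continuous_mult_const:
  "continuous_on S (\<lambda>z. a * z)" "continuous_on S (\<lambda>z. z * a)" "continuous_on S (\<lambda>z. a * z * b)"
  for S :: "'a set"
  by (intro continuous_on_m continuous_on_id continuous_on_const)+

lemma measurable_mult_const:
  "(\<lambda>z. a * z) \<in> M \<rightarrow>\<^sub>M borel" "(\<lambda>z. z * a) \<in> M \<rightarrow>\<^sub>M borel" "(\<lambda>z. a * z * b) \<in> M \<rightarrow>\<^sub>M borel"
  "(\<lambda>z. a * z) \<in> borel \<rightarrow>\<^sub>M borel" "(\<lambda>z. z * a) \<in> borel \<rightarrow>\<^sub>M borel"
  for a b :: 'a
  by (intro measurable_continuous borel_measurable_continuous_onI continuous_mult_const)+

lemma left_absorb:
  "x \<in> T \<Longrightarrow> y \<in> T \<Longrightarrow> distr M borel (\<lambda>z. x * y * z) = distr M borel (\<lambda>z. x * z)"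
  by (rule translate_absorb)

lemma right_absorb:
  "x \<in> T \<Longrightarrow> y \<in> T \<Longrightarrow> distr M borel (\<lambda>z. z * (y * x)) = distr M borel (\<lambda>z. z * x)"
  using idempotent_measure.translate_absorb[OF dual_idempotent] by simp

text \<open>Since \<open>(x * t * x) * (x * z * x) = x * (t * x * x) * z * x\<close>, left
  absorption removes the factor in parentheses, and dually on the right.
  \<open>closed_translates\<close> then carries invariance from \<open>x T x\<close> to its
  closure.\<close>

lemma invariant_measure_sandwich:
  assumes x: "x \<in> T"
  shows "invariant_measure (*) (distr M borel (\<lambda>z. x * z * x)) (closure ((\<lambda>z. x * z * x) ` T))"
    (is "invariant_measure _ ?\<rho> ?H")
proof -
  interpret \<rho>: borel_prob_space ?\<rho>
    by (intro borel_prob_space_distr continuous_mult_const)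
  interpret D: continuous_semigroup "\<lambda>x y :: 'a. y * x" by (rule dual)
  have supp: "topological_support ?\<rho> = ?H"
    by (intro support_distr continuous_mult_const)
  have l: "distr ?\<rho> borel ((*) h) = ?\<rho>" if "h \<in> ?H" for h
  proof -
    have "distr ?\<rho> borel ((*) (x * t * x)) = ?\<rho>" if "t \<in> T" for t
    proof -
      have "distr ?\<rho> borel ((*) (x * t * x)) = distr M borel (\<lambda>z. x * (t * (x * x)) * z * x)"
        using measurable_mult_const by (simp add: distr_distr comp_def mult.assoc)
      also have "\<dots> = distr (distr M borel (\<lambda>z. x * (t * (x * x)) * z)) borel (\<lambda>z. z * x)"
        using measurable_mult_const by (simp add: distr_distr comp_def)
      also have "distr M borel (\<lambda>z. x * (t * (x * x)) * z) = distr M borel (\<lambda>z. x * z)"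
        using x that by (intro left_absorb support_mult_closed)
      also have "distr (distr M borel (\<lambda>z. x * z)) borel (\<lambda>z. z * x) = ?\<rho>"
        using measurable_mult_const by (simp add: distr_distr comp_def)
      finally show ?thesis .
    qed
    then have "?H \<subseteq> {h. distr ?\<rho> borel ((*) h) = ?\<rho>}"
      by (intro closure_minimal closed_translates \<rho>.borel_prob_space_axioms) auto
    with that show ?thesis by blast
  qed
  have r: "distr ?\<rho> borel (\<lambda>z. z * h) = ?\<rho>" if "h \<in> ?H" for h
  proof -
    have "distr ?\<rho> borel (\<lambda>z. z * (x * t * x)) = ?\<rho>" if "t \<in> T" for t
    proof -
      have "distr ?\<rho> borel (\<lambda>z. z * (x * t * x)) = distr M borel (\<lambda>z. x * (z * ((x * x * t) * x)))"
        using measurable_mult_const by (simp add: distr_distr comp_def mult.assoc)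
      also have "\<dots> = distr (distr M borel (\<lambda>z. z * ((x * x * t) * x))) borel (\<lambda>z. x * z)"
        using measurable_mult_const by (simp add: distr_distr comp_def)
      also have "distr M borel (\<lambda>z. z * ((x * x * t) * x)) = distr M borel (\<lambda>z. z * x)"
        using x that by (intro right_absorb support_mult_closed)
      also have "distr (distr M borel (\<lambda>z. z * x)) borel (\<lambda>z. x * z) = ?\<rho>"
        using measurable_mult_const by (simp add: distr_distr comp_def mult.assoc)
      finally show ?thesis .
    qed
    then have "?H \<subseteq> {h. distr ?\<rho> borel (\<lambda>z. z * h) = ?\<rho>}"
      by (intro closure_minimal D.closed_translates \<rho>.borel_prob_space_axioms) auto
    with that show ?thesis by blast
  qed
  let ?A = "(\<lambda>z. x * z * x) ` T"
  \<comment> \<open>By joint continuity the closure of a subsemigroup is a subsemigroup, because the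
    closure of a product set is the product of the closures.\<close>
  have "(\<lambda>p. fst p * snd p) ` (?A \<times> ?A) \<subseteq> ?H"
  proof clarsimp
    fix s t assume "s \<in> T" "t \<in> T"
    then have "x * (s * (x * x) * t) * x \<in> ?A"
      using x by (intro imageI support_mult_closed)
    then have "x * s * x * (x * t * x) \<in> ?A"
      by (simp only: mult.assoc)
    then show "x * s * x * (x * t * x) \<in> ?H"
      by (rule closure_subset[THEN subsetD])
  qed
  then have "(\<lambda>p. fst p * snd p) ` closure (?A \<times> ?A) \<subseteq> ?H"
    by (intro image_closure_subset closed_closure continuous_on_subset[OF continuous_m]) auto
  then have mc: "a * b \<in> ?H" if "a \<in> ?H" "b \<in> ?H" for a b
    using that by (force simp: closure_Times)
  show ?thesis
    by unfold_locales (use supp \<rho>.AE_support l r mc in auto)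
qed

text \<open>The identity of the group carrying the sandwiched measure is an idempotent; it stays in
  \<open>T\<close> because \<open>T\<close> is closed.\<close>

lemma idempotents_support_nonempty: "idempotents T \<noteq> {}"
proof -
  obtain x where x: "x \<in> T" using support_nonempty by blast
  interpret I: invariant_measure "(*)" "distr M borel (\<lambda>z. x * z * x)" "closure ((\<lambda>z. x * z * x) ` T)"
    by (rule invariant_measure_sandwich[OF x])
  obtain e where e: "e \<in> closure ((\<lambda>z. x * z * x) ` T)" "e * e = e"
    by (rule I.group) blast
  have "closure ((\<lambda>z. x * z * x) ` T) \<subseteq> T"
    using x by (intro closure_minimal closed_support) (auto intro: support_mult_closed)
  with e show ?thesis by (auto simp: idempotents_def)
qed

end

section \<open>The compact group at a fixed idempotent and the Rees structure of the support\<close>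

locale convolution_idempotent_at = convolution_idempotent M
  for M :: "'a::{polish_space, topological_semigroup_mult} measure" +
  fixes e :: 'a
  assumes e_idem: "e \<in> idempotents T"
begin

lemma e_in: "e \<in> T" and ee: "e * e = e"
  using e_idem by (auto simp: idempotents_def)

lemma ee': "e * (e * x) = e * x"
  by (simp add: ee flip: mult.assoc)

abbreviation \<Gamma> :: "'a monoid" where "\<Gamma> \<equiv> group_factor T e"

abbreviation \<rho> :: "'a measure" where "\<rho> \<equiv> distr M borel (\<lambda>z. e * z * e)"

abbreviation i :: "'a \<Rightarrow> 'a" where "i \<equiv> m_inv \<Gamma>"

lemma \<Gamma>_simps [simp]: "mult \<Gamma> = (*)" "one \<Gamma> = e"
  by (simp_all add: group_factor_def)

lemma carrier_eq: "carrier \<Gamma> = (\<lambda>z. e * z * e) ` T"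
  by (auto simp: group_factor_def)

text \<open>As a fixed point set inside \<open>T\<close>, the carrier is closed. For an idempotent
  the closure in \<open>invariant_measure_sandwich\<close> is thus \<open>e T e\<close>
  itself.\<close>

lemma carrier_fixed: "carrier \<Gamma> = {z \<in> T. e * z * e = z}"
  using e_in by (auto simp: carrier_eq mult.assoc ee ee' image_iff intro!: support_mult_closed)
    metis

lemma closed_carrier: "closed (carrier \<Gamma>)"
proof -
  have "carrier \<Gamma> = T \<inter> {z. e * z * e = z}"
    by (auto simp: carrier_fixed)
  then show ?thesis
    using closed_Int[OF closed_support closed_Collect_eq[OF continuous_mult_const(3) continuous_on_id]]
    by simp
qed

sublocale H: invariant_measure "(*)" \<rho> "carrier \<Gamma>"
  using invariant_measure_sandwich[OF e_in] closure_closed[OF closed_carrier]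
  by (simp add: carrier_eq)

lemma carrier_unit:
  assumes "g \<in> carrier \<Gamma>"
  shows "e * g = g" "g * e = g" "g \<in> T" "e * (g * x) = g * x" "g * (e * x) = g * x"
proof -
  have "e * g * e = g" "g \<in> T" using assms by (auto simp: carrier_fixed)
  then show *: "e * g = g" "g * e = g" "g \<in> T"
    by (metis ee mult.assoc)+
  then show "e * (g * x) = g * x" "g * (e * x) = g * x"
    by (simp_all flip: mult.assoc)
qed

lemma group_\<Gamma>: "group \<Gamma>"
proof (rule groupI)
  obtain f where f: "f \<in> carrier \<Gamma>" "\<And>x. x \<in> carrier \<Gamma> \<Longrightarrow> f * x = x"
    "\<And>x. x \<in> carrier \<Gamma> \<Longrightarrow> x * f = x"
    "\<And>x. x \<in> carrier \<Gamma> \<Longrightarrow> \<exists>y\<in>carrier \<Gamma>. x * y = f \<and> y * x = f"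
    by (rule H.group) blast
  have e: "e \<in> carrier \<Gamma>" using e_in ee by (simp add: carrier_fixed)
  then show "\<one>\<^bsub>\<Gamma>\<^esub> \<in> carrier \<Gamma>" by simp
  have "f = e" using f(2)[OF e] carrier_unit(2)[OF f(1)] by simp
  then show "\<exists>y\<in>carrier \<Gamma>. y \<otimes>\<^bsub>\<Gamma>\<^esub> x = \<one>\<^bsub>\<Gamma>\<^esub>" if "x \<in> carrier \<Gamma>" for x
    using f(4)[OF that] by auto
qed (simp_all add: H.m_closed carrier_unit mult.assoc)

text \<open>For inversion: its graph \<open>D\<close> is compact, and the first projection maps
  \<open>D\<close> continuously and bijectively onto the carrier, so the inverse of that projection
  is continuous.\<close>

lemma compact_topological_group_\<Gamma>: "compact_topological_group \<Gamma>"
proof -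
  interpret G: group \<Gamma> by (rule group_\<Gamma>)
  define D where "D = carrier \<Gamma> \<times> carrier \<Gamma> \<inter> {p. fst p * snd p = e}"
  have D: "compact D"
    unfolding D_def
    by (intro compact_Int_closed compact_Times H.compact_H closed_Collect_eq continuous_m
        continuous_on_const)
  have graph: "\<forall>p\<in>D. (fst p, i (fst p)) = p"
    using G.inv_equality by (auto simp: D_def) (metis G.inv_solve_left' G.r_one \<Gamma>_simps G.inv_closed G.one_closed)
  have fst_D: "fst ` D = carrier \<Gamma>"
  proof -
    have "(x, i x) \<in> D" if "x \<in> carrier \<Gamma>" for x
      using that G.r_inv[OF that] by (simp add: D_def)
    then have "x \<in> fst ` D" if "x \<in> carrier \<Gamma>" for x
      using that by (intro image_eqI[of x fst "(x, i x)"]) simp_all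
    then have "carrier \<Gamma> \<subseteq> fst ` D" by (rule subsetI)
    moreover have "fst ` D \<subseteq> carrier \<Gamma>" unfolding D_def by auto
    ultimately show ?thesis by (rule equalityI[rotated])
  qed
  have "continuous_on (fst ` D) (\<lambda>x. (x, i x))"
    by (rule continuous_on_inv[OF continuous_on_fst[OF continuous_on_id] D graph])
  then have "continuous_on (carrier \<Gamma>) i"
    using continuous_on_snd[of _ "\<lambda>x. (x, i x)"] by (simp add: fst_D)
  moreover have "continuous_on (carrier \<Gamma> \<times> carrier \<Gamma>) (\<lambda>(x, y). x * y)"
    using continuous_on_subset[OF continuous_m] by (simp add: case_prod_beta')
  ultimately show ?thesis
    by (simp add: compact_topological_group_def group_\<Gamma> H.compact_H)
qed

lemma i_simps:
  assumes "g \<in> carrier \<Gamma>"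
  shows "i g \<in> carrier \<Gamma>" "i g * g = e" "g * i g = e" "i g * (g * x) = e * x" "g * (i g * x) = e * x"
proof -
  interpret G: group \<Gamma> by (rule group_\<Gamma>)
  show *: "i g \<in> carrier \<Gamma>" "i g * g = e" "g * i g = e"
    using G.inv_closed[OF assms] G.l_inv[OF assms] G.r_inv[OF assms] by auto
  then show "i g * (g * x) = e * x" "g * (i g * x) = e * x"
    by (simp_all flip: mult.assoc)
qed

lemma continuous_on_i: "continuous_on (carrier \<Gamma>) i"
  using compact_topological_group_\<Gamma> by (simp add: compact_topological_group_def)

lemma sandwich_in_carrier: "z \<in> T \<Longrightarrow> e * z * e \<in> carrier \<Gamma>"
  by (simp add: carrier_eq)

lemma continuous_on_rees_inv: "continuous_on T (\<lambda>z. i (e * z * e))"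
  by (rule continuous_on_compose2[OF continuous_on_i continuous_mult_const(3)])
    (auto simp: sandwich_in_carrier)

lemma AE_pair_support: "AE p in M \<Otimes>\<^sub>M M. fst p \<in> T \<and> snd p \<in> T"
proof -
  interpret pair_prob_space M M ..
  interpret P: borel_prob_space "M \<Otimes>\<^sub>M M" by (rule borel_prob_space_pair)
  have "{p \<in> space (M \<Otimes>\<^sub>M M). fst p \<in> T \<and> snd p \<in> T} = T \<times> T"
    unfolding P.space_M by auto
  moreover have "T \<times> T \<in> sets (M \<Otimes>\<^sub>M M)"
    unfolding P.sets_M by (intro borel_closed closed_Times closed_support)
  ultimately have m: "{p \<in> space (M \<Otimes>\<^sub>M M). fst p \<in> T \<and> snd p \<in> T} \<in> sets (M \<Otimes>\<^sub>M M)"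
    by (simp only:)
  have "AE x in M. AE y in M. fst (x, y) \<in> T \<and> snd (x, y) \<in> T"
    using AE_support
  proof (rule eventually_mono)
    fix x assume "x \<in> T"
    then show "AE y in M. fst (x, y) \<in> T \<and> snd (x, y) \<in> T" using AE_support by simp
  qed
  then show ?thesis by (rule AE_pair_measure[OF m])
qed

text \<open>\<open>\<mu> * \<delta>\<^sub>e * \<mu> = \<mu>\<close>, because \<open>\<delta>\<^sub>x * \<delta>\<^sub>e * \<mu> = \<delta>\<^sub>x * \<mu>\<close> for \<open>x\<close> in the support.\<close>

lemma distr_mult_e_mult: "distr (M \<Otimes>\<^sub>M M) borel (\<lambda>p. fst p * e * snd p) = M"
proof -
  interpret P: borel_prob_space "M \<Otimes>\<^sub>M M" by (rule borel_prob_space_pair)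
  have "distr (M \<Otimes>\<^sub>M M) borel (\<lambda>p. fst p * e * snd p) = distr (M \<Otimes>\<^sub>M M) borel (\<lambda>p. fst p * snd p)"
  proof (rule distr_pair_cong_snd)
    show "(\<lambda>p. fst p * e * snd p) \<in> M \<Otimes>\<^sub>M M \<rightarrow>\<^sub>M borel"
      by (intro P.measurable_continuous continuous_on_m continuous_on_fst continuous_on_snd
          continuous_on_id continuous_on_const)
    show "AE x in M. distr M borel (\<lambda>y. fst (x, y) * e * snd (x, y)) =
        distr M borel (\<lambda>y. fst (x, y) * snd (x, y))"
      using AE_support by (rule eventually_mono) (simp add: left_absorb e_in)
  qed (simp_all add: borel_prob_space_axioms P.measurable_continuous[OF continuous_m])
  then show ?thesis
    using convolution_idem by (simp add: case_prod_beta')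
qed

text \<open>On products \<open>x * e * y\<close> the identity follows by inverting
  \<open>(e * x * e) * (e * y * e)\<close> in the group. By \<open>distr_mult_e_mult\<close> almost
  every point is such a product, and the identity is a closed condition.\<close>

lemma rees_factorization:
  assumes "z \<in> T"
  shows "z * e * i (e * z * e) * (e * z) = z"
proof -
  interpret G: group \<Gamma> by (rule group_\<Gamma>)
  interpret P: borel_prob_space "M \<Otimes>\<^sub>M M" by (rule borel_prob_space_pair)
  define \<phi> where "\<phi> z = z * e * i (e * z * e) * (e * z)" for z
  \<comment> \<open>Membership in \<open>T\<close> is part of the condition because the group
    inverse, and with it \<open>\<phi>\<close>, is known to be continuous only there.\<close>
  define C where "C = T \<inter> (\<lambda>z. (\<phi> z, z)) -` {p. \<exists>x. p = (x, x)}"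
  have "closed C"
    unfolding C_def \<phi>_def
    by (intro continuous_closed_preimage closed_support closed_diagonal continuous_on_Pair
        continuous_on_m continuous_on_rees_inv continuous_on_id continuous_on_const)
  have C: "x * e * y \<in> C" if xy: "x \<in> T" "y \<in> T" for x y
  proof -
    define a b where "a = e * x * e" and "b = e * y * e"
    have ab: "a \<in> carrier \<Gamma>" "b \<in> carrier \<Gamma>"
      using xy by (auto simp: a_def b_def sandwich_in_carrier)
    have "e * (x * e * y) * e = a * b"
      by (simp add: a_def b_def mult.assoc ee')
    then have "\<phi> (x * e * y) = x * e * y * e * (i b * i a) * (e * (x * e * y))"
      using G.inv_mult_group[OF ab] by (simp add: \<phi>_def)
    also have "\<dots> = x * (b * (i b * (i a * (a * y))))"
      by (simp add: a_def b_def mult.assoc ee')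
    also have "\<dots> = x * e * y"
      using ab by (simp add: i_simps carrier_unit mult.assoc ee')
    finally show ?thesis
      using xy e_in by (simp add: C_def support_mult_closed)
  qed
  have "AE p in M \<Otimes>\<^sub>M M. fst p * e * snd p \<in> C"
    using AE_pair_support by (rule eventually_mono) (simp add: C)
  moreover have "(\<lambda>p. fst p * e * snd p) \<in> M \<Otimes>\<^sub>M M \<rightarrow>\<^sub>M borel"
    by (intro P.measurable_continuous continuous_on_m continuous_on_fst continuous_on_snd
        continuous_on_id continuous_on_const)
  ultimately have "AE z in distr (M \<Otimes>\<^sub>M M) borel (\<lambda>p. fst p * e * snd p). z \<in> C"
    using \<open>closed C\<close> by (subst AE_distr_iff) auto
  then have "T \<subseteq> C"
    unfolding distr_mult_e_mult by (rule support_subset_AE[OF \<open>closed C\<close>])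
  with assms show ?thesis by (auto simp: C_def \<phi>_def)
qed

text \<open>An ideal containing \<open>j\<close> contains the group element
  \<open>e * j * e\<close>, hence \<open>e\<close>, and then every \<open>z\<close>, because
  \<open>e\<close> is a factor in the Rees factorization of \<open>z\<close>.\<close>

lemma simple_support: "simple_semigroup T"
  unfolding simple_semigroup_def subsemigroup_def
proof (intro conjI allI impI ballI)
  fix I assume "semigroup_ideal T I"
  then obtain j where I: "I \<subseteq> T" "j \<in> I" "\<And>t x. t \<in> T \<Longrightarrow> x \<in> I \<Longrightarrow> t * x \<in> I"
      "\<And>t x. t \<in> T \<Longrightarrow> x \<in> I \<Longrightarrow> x * t \<in> I"
    unfolding semigroup_ideal_def by blast
  have g: "e * j * e \<in> carrier \<Gamma>" "e * j * e \<in> I"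
    using I e_in by (auto intro: sandwich_in_carrier)
  then have "e * j * e * i (e * j * e) \<in> I"
    using I(4) i_simps(1) carrier_unit(3) by blast
  then have e: "e \<in> I" using g i_simps by simp
  have "z \<in> I" if "z \<in> T" for z
  proof -
    have "i (e * z * e) * (e * z) \<in> T"
      using that e_in sandwich_in_carrier i_simps(1) carrier_unit(3) support_mult_closed by metis
    then have "z * e * (i (e * z * e) * (e * z)) \<in> I"
      using I(3)[OF that e] I(4) by blast
    then show ?thesis
      using rees_factorization[OF that] by (simp add: mult.assoc)
  qed
  with I(1) show "I = T" by blast
qed (rule support_mult_closed)

text \<open>An idempotent below \<open>e\<close> lies in the group \<open>e T e\<close>, whose only
  idempotent is its identity.\<close>

lemma primitive_e: "primitive_idempotent T e"
  unfolding primitive_idempotent_def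
proof (intro conjI e_idem ballI impI)
  fix x assume x: "x \<in> idempotents T" "e * x = x \<and> x * e = x"
  then have "x \<in> carrier \<Gamma>" "x * x = x"
    by (auto simp: idempotents_def carrier_fixed)
  then show "x = e"
    using i_simps(4)[of x x] i_simps(2)[of x] x(2) by simp
qed

text \<open>Haar invariance is phrased with images of sets, invariance of \<open>\<rho>\<close> with
  push-forwards. On the carrier, the image under translation by \<open>g\<close> is the preimage
  under translation by \<open>i g\<close>.\<close>

lemma normalized_haar_\<rho>: "normalized_haar \<Gamma> \<rho>"
  unfolding normalized_haar_def
proof (intro conjI ballI impI)
  show "prob_space \<rho>" by (rule H.prob_space_axioms)
  show "emeasure \<rho> (carrier \<Gamma>) = 1"
    using H.prob_H by (simp add: H.emeasure_eq_measure)
  fix g B assume g: "g \<in> carrier \<Gamma>" and B: "B \<in> sets borel" "B \<subseteq> carrier \<Gamma>"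
  have *: "AE z in \<rho>. z \<in> carrier \<Gamma>" by (rule H.AE_H)
  have ml: "(\<lambda>z. h * z) \<in> \<rho> \<rightarrow>\<^sub>M borel" and mr: "(\<lambda>z. z * h) \<in> \<rho> \<rightarrow>\<^sub>M borel" for h
    by (intro H.measurable_continuous continuous_mult_const)+
  have "(\<lambda>x. g * x) ` B = (\<lambda>x. i g * x) -` B \<inter> carrier \<Gamma>"
  proof (intro equalityI subsetI)
    fix x assume x: "x \<in> (\<lambda>x. i g * x) -` B \<inter> carrier \<Gamma>"
    then have "x = g * (i g * x)" using g by (simp add: i_simps carrier_unit)
    with x show "x \<in> (\<lambda>x. g * x) ` B" by blast
  qed (use g B in \<open>auto simp: i_simps carrier_unit H.m_closed subset_iff\<close>)
  also have "emeasure \<rho> \<dots> = emeasure \<rho> ((\<lambda>x. i g * x) -` B \<inter> space \<rho>)"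
    using measurable_sets[OF ml B(1), of "i g"] closed_carrier *
    by (intro emeasure_eq_AE) auto
  also have "\<dots> = emeasure (distr \<rho> borel (\<lambda>x. i g * x)) B"
    by (rule emeasure_distr[OF ml B(1), symmetric])
  also have "\<dots> = emeasure \<rho> B"
    using H.left_invariant[OF i_simps(1)[OF g]] by simp
  finally show "emeasure \<rho> ((\<lambda>x. g \<otimes>\<^bsub>\<Gamma>\<^esub> x) ` B) = emeasure \<rho> B" by simp
  have "(\<lambda>x. x * g) ` B = (\<lambda>x. x * i g) -` B \<inter> carrier \<Gamma>"
  proof (intro equalityI subsetI)
    fix x assume x: "x \<in> (\<lambda>x. x * i g) -` B \<inter> carrier \<Gamma>"
    then have "x = (x * i g) * g" using g by (simp add: i_simps carrier_unit mult.assoc)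
    with x show "x \<in> (\<lambda>x. x * g) ` B" by blast
  qed (use g B in \<open>auto simp: i_simps carrier_unit H.m_closed subset_iff mult.assoc\<close>)
  also have "emeasure \<rho> \<dots> = emeasure \<rho> ((\<lambda>x. x * i g) -` B \<inter> space \<rho>)"
    using measurable_sets[OF mr B(1), of "i g"] closed_carrier *
    by (intro emeasure_eq_AE) auto
  also have "\<dots> = emeasure (distr \<rho> borel (\<lambda>x. x * i g)) B"
    by (rule emeasure_distr[OF mr B(1), symmetric])
  also have "\<dots> = emeasure \<rho> B"
    using H.right_invariant[OF i_simps(1)[OF g]] by simp
  finally show "emeasure \<rho> ((\<lambda>x. x \<otimes>\<^bsub>\<Gamma>\<^esub> g) ` B) = emeasure \<rho> B" by simp
qed (use closed_carrier in auto)

text \<open>Both \<open>\<omega>\<close> and \<open>\<rho>\<close> equal \<open>\<omega> * \<rho>\<close>, by right invariance of \<open>\<omega>\<close> and left invariance of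
  \<open>\<rho>\<close>.\<close>

lemma normalized_haar_unique:
  assumes "normalized_haar \<Gamma> \<omega>"
  shows "\<omega> = \<rho>"
proof -
  have \<omega>: "prob_space \<omega>" "sets \<omega> = sets borel" "emeasure \<omega> (carrier \<Gamma>) = 1"
    and inv: "\<And>g B. g \<in> carrier \<Gamma> \<Longrightarrow> B \<in> sets borel \<Longrightarrow> B \<subseteq> carrier \<Gamma> \<Longrightarrow>
        emeasure \<omega> ((\<lambda>x. x * g) ` B) = emeasure \<omega> B"
    using assms by (auto simp: normalized_haar_def)
  interpret W: borel_prob_space \<omega>
    using \<omega>(1,2) by (simp add: borel_prob_space_def borel_prob_space_axioms_def)
  have AE: "AE z in \<omega>. z \<in> carrier \<Gamma>"
    using \<omega>(3) by (intro W.AE_prob_1) (simp add: W.emeasure_eq_measure)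
  \<comment> \<open>The assumed invariance concerns only Borel subsets of the carrier; since
    \<open>\<omega>\<close> is concentrated there, it extends to a push-forward identity on all
    Borel sets.\<close>
  have right: "distr \<omega> borel (\<lambda>x. x * g) = \<omega>" if g: "g \<in> carrier \<Gamma>" for g
  proof (rule measure_eqI)
    fix B assume "B \<in> sets (distr \<omega> borel (\<lambda>x. x * g))"
    then have B: "B \<in> sets borel" by simp
    have mr: "(\<lambda>z. z * g) \<in> \<omega> \<rightarrow>\<^sub>M borel"
      by (intro W.measurable_continuous continuous_mult_const)
    have eq: "(\<lambda>x. x * g) -` B \<inter> carrier \<Gamma> = (\<lambda>x. x * i g) ` (B \<inter> carrier \<Gamma>)"
    proof (intro equalityI subsetI)
      fix x assume x: "x \<in> (\<lambda>x. x * g) -` B \<inter> carrier \<Gamma>"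
      then have "x = (x * g) * i g" "x * g \<in> B \<inter> carrier \<Gamma>"
        using g by (simp_all add: i_simps carrier_unit mult.assoc H.m_closed)
      then show "x \<in> (\<lambda>x. x * i g) ` (B \<inter> carrier \<Gamma>)" by blast
    qed (use g in \<open>auto simp: i_simps carrier_unit H.m_closed mult.assoc\<close>)
    have "emeasure (distr \<omega> borel (\<lambda>x. x * g)) B = emeasure \<omega> ((\<lambda>x. x * g) -` B \<inter> space \<omega>)"
      by (rule emeasure_distr[OF mr B])
    also have "\<dots> = emeasure \<omega> ((\<lambda>x. x * g) -` B \<inter> carrier \<Gamma>)"
      using measurable_sets[OF mr B] closed_carrier AE
      by (intro emeasure_eq_AE) auto
    also have "\<dots> = emeasure \<omega> (B \<inter> carrier \<Gamma>)"
      unfolding eq using B closed_carrier by (intro inv i_simps(1)[OF g]) auto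
    also have "\<dots> = emeasure \<omega> B"
      using B closed_carrier AE by (intro emeasure_eq_AE) auto
    finally show "emeasure (distr \<omega> borel (\<lambda>x. x * g)) B = emeasure \<omega> B" .
  qed simp
  have W: "borel_prob_space \<omega>" "borel_prob_space \<rho>"
    by (rule W.borel_prob_space_axioms H.borel_prob_space_axioms)+
  interpret pair_prob_space \<omega> \<rho> ..
  have mult: "(\<lambda>p. fst p * snd p) \<in> \<omega> \<Otimes>\<^sub>M \<rho> \<rightarrow>\<^sub>M borel"
    using \<omega>(2) by (intro measurable_mult_pair) simp_all
  have fst: "fst \<in> \<omega> \<Otimes>\<^sub>M \<rho> \<rightarrow>\<^sub>M borel" and snd: "snd \<in> \<omega> \<Otimes>\<^sub>M \<rho> \<rightarrow>\<^sub>M borel"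
    using measurable_compose[OF measurable_fst] measurable_compose[OF measurable_snd]
    by (auto simp: W.measurable_iff_borel H.measurable_iff_borel)
  have "distr (\<omega> \<Otimes>\<^sub>M \<rho>) borel (\<lambda>p. fst p * snd p) = distr (\<omega> \<Otimes>\<^sub>M \<rho>) borel fst"
    by (rule distr_pair_cong_fst[OF W mult fst])
      (use H.AE_H right distr_id2[OF \<omega>(2)[symmetric]] in \<open>auto elim: eventually_mono\<close>)
  also have "\<dots> = distr (\<omega> \<Otimes>\<^sub>M \<rho>) \<omega> fst"
    using \<omega>(2) by (intro distr_cong) simp_all
  also have "\<dots> = \<omega>"
    by (rule prob_space.distr_pair_fst[OF H.prob_space_axioms])
  finally have 1: "distr (\<omega> \<Otimes>\<^sub>M \<rho>) borel (\<lambda>p. fst p * snd p) = \<omega>" .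
  have "distr (\<omega> \<Otimes>\<^sub>M \<rho>) borel (\<lambda>p. fst p * snd p) = distr (\<omega> \<Otimes>\<^sub>M \<rho>) borel snd"
    by (rule distr_pair_cong_snd[OF W mult snd])
      (use AE H.left_invariant distr_id2[OF H.sets_M[symmetric]] in \<open>auto elim: eventually_mono\<close>)
  also have "\<dots> = \<rho>"
  proof (rule measure_eqI)
    fix A assume "A \<in> sets (distr (\<omega> \<Otimes>\<^sub>M \<rho>) borel snd)"
    then have A: "A \<in> sets borel" by simp
    have "emeasure (distr (\<omega> \<Otimes>\<^sub>M \<rho>) borel snd) A = emeasure (\<omega> \<Otimes>\<^sub>M \<rho>) (space \<omega> \<times> A)"
      unfolding emeasure_distr[OF snd A]
      by (rule arg_cong[where f="emeasure (\<omega> \<Otimes>\<^sub>M \<rho>)"]) (auto simp: space_pair_measure)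
    also have "\<dots> = emeasure \<omega> (space \<omega>) * emeasure \<rho> A"
      using A by (intro H.emeasure_pair_measure_Times) simp_all
    finally show "emeasure (distr (\<omega> \<Otimes>\<^sub>M \<rho>) borel snd) A = emeasure \<rho> A"
      using W.emeasure_space_1 by simp
  qed simp
  finally show ?thesis using 1 by simp
qed

end

section \<open>Laws of the Rees coordinates and the convolution factorization\<close>

context convolution_idempotent_at
begin

text \<open>On the support \<open>z\<^sup>L = z s\<close> and \<open>z\<^sup>R = s z\<close> with \<open>s\<close> in the support, so absorption allows \<open>z\<close>
  and its Rees coordinate to be exchanged next to any factor \<open>\<mu>\<close>.\<close>

lemma rees_L_absorb:
  assumes z: "z \<in> T"
  shows "distr M borel (\<lambda>y. rees_L T e z * y) = distr M borel (\<lambda>y. z * y)"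
proof -
  have "e * i (e * z * e) \<in> T"
    using e_in carrier_unit(3)[OF i_simps(1)[OF sandwich_in_carrier[OF z]]]
    by (rule support_mult_closed)
  from left_absorb[OF z this] show ?thesis
    by (simp add: rees_L_def mult.assoc)
qed

lemma rees_R_absorb:
  assumes z: "z \<in> T"
  shows "distr M borel (\<lambda>y. y * rees_R T e z) = distr M borel (\<lambda>y. y * z)"
proof -
  have "i (e * z * e) * e \<in> T"
    using carrier_unit(3)[OF i_simps(1)[OF sandwich_in_carrier[OF z]]] e_in
    by (rule support_mult_closed)
  from right_absorb[OF z this] show ?thesis
    by (simp add: rees_R_def mult.assoc)
qed

text \<open>The coordinates are continuous on the closed set \<open>T\<close>; giving them the
  default value \<open>e\<close> on its null complement yields a Borel map on the whole
  space.\<close>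

lemma law_as_distr:
  assumes g: "continuous_on T g"
  shows "distr (restrict_space M T) borel g = distr M borel (\<lambda>z. if z \<in> T then g z else e)"
    and "(\<lambda>z. if z \<in> T then g z else e) \<in> M \<rightarrow>\<^sub>M borel"
proof -
  have "(\<lambda>z. if z \<in> T then g z else e) \<in> borel_measurable borel"
    using closed_support by (intro borel_measurable_continuous_on_if g continuous_on_const) auto
  then show m: "(\<lambda>z. if z \<in> T then g z else e) \<in> M \<rightarrow>\<^sub>M borel"
    by (simp add: measurable_iff_borel)
  show "distr (restrict_space M T) borel g = distr M borel (\<lambda>z. if z \<in> T then g z else e)"
    using closed_support by (intro distr_restrict_space_full[OF _ AE_support m]) auto
qed

lemma continuous_on_rees: "continuous_on T (rees_L T e)" "continuous_on T (rees_R T e)"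
  unfolding rees_L_def rees_R_def
  by (intro continuous_on_m continuous_on_rees_inv continuous_on_id continuous_on_const)+

text \<open>Absorption replaces the left coordinate by \<open>z\<close> itself, which leaves
  \<open>M * \<rho>\<close>. Expanding \<open>\<rho>\<close> as \<open>M\<close> between two point
  masses at \<open>e\<close> and using \<open>distr_mult_e_mult\<close> reduces this to
  \<open>M\<close> translated by \<open>e\<close>.\<close>

lemma law_L_convolution: "law_L M e \<circledast> \<rho> = distr M borel (\<lambda>z. z * e)"
proof -
  define L where "L z = (if z \<in> T then rees_L T e z else e)" for z
  have L: "L \<in> M \<rightarrow>\<^sub>M borel" "law_L M e = distr M borel L"
    unfolding L_def law_L_def using law_as_distr[OF continuous_on_rees(1)] by simp_all
  interpret P: borel_prob_space "M \<Otimes>\<^sub>M M" by (rule borel_prob_space_pair)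
  have sandwich: "(\<lambda>z. e * z * e) \<in> M \<rightarrow>\<^sub>M borel" by (rule measurable_mult_const)
  have pe: "(\<lambda>p. fst p * e * snd p * e) \<in> M \<Otimes>\<^sub>M M \<rightarrow>\<^sub>M borel"
    "(\<lambda>p. fst p * e * snd p) \<in> M \<Otimes>\<^sub>M M \<rightarrow>\<^sub>M borel"
    by (intro P.measurable_continuous continuous_on_m continuous_on_fst continuous_on_snd
        continuous_on_id continuous_on_const)+
  have Lfst: "(\<lambda>p. L (fst p)) \<in> M \<Otimes>\<^sub>M \<rho> \<rightarrow>\<^sub>M borel" "(\<lambda>p. fst p) \<in> M \<Otimes>\<^sub>M \<rho> \<rightarrow>\<^sub>M borel"
    "(\<lambda>p. snd p) \<in> M \<Otimes>\<^sub>M \<rho> \<rightarrow>\<^sub>M borel"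
    using measurable_compose[OF measurable_fst L(1)] measurable_compose[OF measurable_fst, of "\<lambda>x. x" M borel]
      measurable_compose[OF measurable_snd, of "\<lambda>x. x" \<rho> borel]
    by (auto simp: measurable_iff_borel H.measurable_iff_borel)
  have "law_L M e \<circledast> \<rho> = distr (M \<Otimes>\<^sub>M \<rho>) borel (\<lambda>p. L (fst p) * snd p)"
    unfolding L(2) by (intro mult_convolution_distr_left L(1) H.prob_space_axioms) simp
  also have "\<dots> = distr (M \<Otimes>\<^sub>M \<rho>) borel (\<lambda>p. fst p * snd p)"
  proof (rule distr_pair_cong_snd)
    show "(\<lambda>p. L (fst p) * snd p) \<in> M \<Otimes>\<^sub>M \<rho> \<rightarrow>\<^sub>M borel"
      "(\<lambda>p. fst p * snd p) \<in> M \<Otimes>\<^sub>M \<rho> \<rightarrow>\<^sub>M borel"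
      by (intro measurable_mult Lfst)+
    show "AE x in M. distr \<rho> borel (\<lambda>y. L (fst (x, y)) * snd (x, y)) =
        distr \<rho> borel (\<lambda>y. fst (x, y) * snd (x, y))"
      using AE_support
    proof (rule eventually_mono)
      fix x assume x: "x \<in> T"
      \<comment> \<open>Sections against \<open>\<rho>\<close> carry an extra \<open>e\<close> next
        to \<open>a\<close>. The left coordinate already ends in \<open>e\<close>, while for
        \<open>x\<close> the extra factor is absorbed.\<close>
      have *: "distr \<rho> borel (\<lambda>y. a * y) = distr (distr M borel (\<lambda>y. a * e * y)) borel (\<lambda>y. y * e)" for a
        using measurable_mult_const sandwich by (simp add: distr_distr comp_def mult.assoc)
      have "L x * e = L x"
        using x carrier_unit(2)[OF i_simps(1)[OF sandwich_in_carrier[OF x]]]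
        by (simp add: L_def rees_L_def mult.assoc)
      then have "distr M borel (\<lambda>y. L x * e * y) = distr M borel (\<lambda>y. x * e * y)"
        using x rees_L_absorb[OF x] left_absorb[OF x e_in] by (simp add: L_def)
      then show "distr \<rho> borel (\<lambda>y. L (fst (x, y)) * snd (x, y)) =
          distr \<rho> borel (\<lambda>y. fst (x, y) * snd (x, y))"
        by (simp add: *)
    qed
  qed (rule borel_prob_space_axioms H.borel_prob_space_axioms)+
  also have "\<dots> = M \<circledast> \<rho>"
    by (simp add: mult_convolution_def case_prod_beta')
  also have "\<dots> = distr (M \<Otimes>\<^sub>M M) borel (\<lambda>p. fst p * (e * snd p * e))"
    by (intro mult_convolution_distr_right sandwich prob_space_axioms) simp
  also have "\<dots> = distr (distr (M \<Otimes>\<^sub>M M) borel (\<lambda>p. fst p * e * snd p)) borel (\<lambda>z. z * e)"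
    using pe measurable_mult_const by (simp add: distr_distr comp_def mult.assoc)
  also have "\<dots> = distr M borel (\<lambda>z. z * e)"
    by (simp add: distr_mult_e_mult)
  finally show ?thesis .
qed

text \<open>Absorption on the right replaces the right coordinate by \<open>z\<close>; what remains
  is \<open>M\<close> convolved with the point mass at \<open>e\<close> and with \<open>M\<close>,
  which is \<open>M\<close>.\<close>

lemma convolution_law_R: "distr M borel (\<lambda>z. z * e) \<circledast> law_R M e = M"
proof -
  define R where "R z = (if z \<in> T then rees_R T e z else e)" for z
  have R: "R \<in> M \<rightarrow>\<^sub>M borel" "law_R M e = distr M borel R"
    unfolding R_def law_R_def using law_as_distr[OF continuous_on_rees(2)] by simp_all
  interpret E: borel_prob_space "distr M borel (\<lambda>z. z * e)"
    by (intro borel_prob_space_distr continuous_mult_const)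
  let ?E = "distr M borel (\<lambda>z. z * e)"
  have Rsnd: "(\<lambda>p. R (snd p)) \<in> ?E \<Otimes>\<^sub>M M \<rightarrow>\<^sub>M borel" "(\<lambda>p. fst p) \<in> ?E \<Otimes>\<^sub>M M \<rightarrow>\<^sub>M borel"
    "(\<lambda>p. snd p) \<in> ?E \<Otimes>\<^sub>M M \<rightarrow>\<^sub>M borel"
    using measurable_compose[OF measurable_snd R(1)] measurable_compose[OF measurable_snd, of "\<lambda>x. x" M borel]
      measurable_compose[OF measurable_fst, of "\<lambda>x. x" ?E borel]
    by (auto simp: measurable_iff_borel E.measurable_iff_borel)
  have "?E \<circledast> law_R M e = distr (?E \<Otimes>\<^sub>M M) borel (\<lambda>p. fst p * R (snd p))"
    unfolding R(2) by (intro mult_convolution_distr_right R(1) prob_space_axioms) simp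
  also have "\<dots> = distr (?E \<Otimes>\<^sub>M M) borel (\<lambda>p. fst p * snd p)"
  proof (rule distr_pair_cong_fst)
    show "(\<lambda>p. fst p * R (snd p)) \<in> ?E \<Otimes>\<^sub>M M \<rightarrow>\<^sub>M borel"
      "(\<lambda>p. fst p * snd p) \<in> ?E \<Otimes>\<^sub>M M \<rightarrow>\<^sub>M borel"
      by (intro measurable_mult Rsnd)+
    show "AE z in M. distr ?E borel (\<lambda>x. fst (x, z) * R (snd (x, z))) =
        distr ?E borel (\<lambda>x. fst (x, z) * snd (x, z))"
      using AE_support
    proof (rule eventually_mono)
      fix z assume z: "z \<in> T"
      have *: "distr ?E borel (\<lambda>x. x * a) = distr M borel (\<lambda>x. x * (e * a))" for a
        using measurable_mult_const by (simp add: distr_distr comp_def mult.assoc)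
      have "e * R z = R z"
        using z carrier_unit(4)[OF i_simps(1)[OF sandwich_in_carrier[OF z]]]
        by (simp add: R_def rees_R_def)
      then have "distr M borel (\<lambda>x. x * (e * R z)) = distr M borel (\<lambda>x. x * (e * z))"
        using z rees_R_absorb[OF z] right_absorb[OF z e_in] by (simp add: R_def)
      then show "distr ?E borel (\<lambda>x. fst (x, z) * R (snd (x, z))) =
          distr ?E borel (\<lambda>x. fst (x, z) * snd (x, z))"
        by (simp add: *)
    qed
  qed (rule borel_prob_space_axioms E.borel_prob_space_axioms)+
  also have "\<dots> = ?E \<circledast> M"
    by (simp add: mult_convolution_def case_prod_beta')
  also have "\<dots> = distr (M \<Otimes>\<^sub>M M) borel (\<lambda>p. fst p * e * snd p)"
    by (intro mult_convolution_distr_left measurable_mult_const prob_space_axioms) simp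
  finally show ?thesis by (simp only: distr_mult_e_mult)
qed

end

section \<open>Complete simplicity, compact group factor and factorization combined\<close>

theorem theorem4p6:
  fixes \<mu> :: "'a::{polish_space, topological_semigroup_mult} measure"
  assumes "prob_space \<mu>"
    and "sets \<mu> = sets borel"
    and "\<mu> \<circledast> \<mu> = \<mu>"
  shows "completely_simple (topological_support \<mu>) \<and>
    (\<forall>e \<in> idempotents (topological_support \<mu>).
       compact_topological_group (group_factor (topological_support \<mu>) e) \<and>
       (\<exists>!\<omega>. normalized_haar (group_factor (topological_support \<mu>) e) \<omega>) \<and>
       \<mu> = law_L \<mu> e \<circledast> haar_measure (group_factor (topological_support \<mu>) e) \<circledast> law_R \<mu> e)"
proof -
  interpret prob_space \<mu> by fact
  have "continuous_on UNIV (\<lambda>p::'a \<times> 'a. fst p * snd p)"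
    by (intro continuous_on_mult_semigroup continuous_on_fst continuous_on_snd continuous_on_id)
  then interpret convolution_idempotent \<mu>
    using assms(2,3) by unfold_locales (simp_all add: mult.assoc mult_convolution_def)
  have at: "convolution_idempotent_at \<mu> e" if "e \<in> idempotents (topological_support \<mu>)" for e
    using that by unfold_locales
  show ?thesis
  proof (intro conjI ballI)
    \<comment> \<open>Simplicity is derived through the Rees factorization at one idempotent; any
      choice serves.\<close>
    obtain e where e: "e \<in> idempotents (topological_support \<mu>)"
      using idempotents_support_nonempty by blast
    interpret convolution_idempotent_at \<mu> e by (rule at[OF e])
    show "completely_simple (topological_support \<mu>)"
      using simple_support primitive_e by (auto simp: completely_simple_def)
  next
    fix e assume e: "e \<in> idempotents (topological_support \<mu>)"
    interpret convolution_idempotent_at \<mu> e by (rule at[OF e])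
    show "compact_topological_group (group_factor (topological_support \<mu>) e)"
      by (rule compact_topological_group_\<Gamma>)
    show ex1: "\<exists>!\<omega>. normalized_haar (group_factor (topological_support \<mu>) e) \<omega>"
      using normalized_haar_\<rho> normalized_haar_unique by blast
    have "haar_measure (group_factor (topological_support \<mu>) e) = \<rho>"
      unfolding haar_measure_def by (rule the1_equality[OF ex1 normalized_haar_\<rho>])
    then show "\<mu> = law_L \<mu> e \<circledast> haar_measure (group_factor (topological_support \<mu>) e) \<circledast> law_R \<mu> e"
      by (simp add: law_L_convolution convolution_law_R)
  qed
qed

end
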